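(* Let $s\geq 2$, $t\geq 1$, $d'\geq 1$ and $n\geq 3$ be integers, and let $A_1,\ldots,A_n$ be $n$ nontrivial partitions of $sd'$ of the form $$A_1=[sa_{11},sa_{12},\ldots,sa_{1r_1}],\quad A_2=[sa_{21},sa_{22},\ldots,sa_{2r_2}],\quad A_3=[ta_{31},ta_{32},\ldots,ta_{3r_3}],$$ $$A_k=[a_{k1},a_{k2},\ldots,a_{kr_k}]\quad (4\leq k\leq n),$$ where all $a_{kl}\geq 1$ are integers. If there exists a branched cover $f:S^2\to S^2$ with branching data $\mathcal{D}=\{A_1,A_2,\ldots,A_n\}$, then the following hold: (1) If $s\geq 4$, then $t=1$. (2) If $s=3$, then $t\in\{1,2\}$; moreover, when $t=2$, we have $4\mid d'$. (3) If $s=2$, then $t\geq 1$; furthermore, if $t\geq 2$, then $t$ divides $d'$.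
   Context: A branched cover $f:Y\to X$ between compact, connected, orientable surfaces is a surjective map that is locally modeled on the power maps $\mathbb{C}\ni z\mapsto z^m\in\mathbb{C}$ for positive integers $m$; $m$ is the local degree at the preimage point corresponding to $0$. A point of $X$ having a preimage of local degree greater than $1$ is a branch point; there are finitely many of them. Removing the branch points and their preimages gives a genuine covering map, whose degree $d$ is called the degree of $f$. A partition of $d$ is a multiset $[b_1,\ldots,b_r]$ of positive integers with sum $d$; it is nontrivial if at least one part is greater than $1$. The local degrees at the preimages of each branch point form a nontrivial partition of $d$. If $f$ has $n$ branch points, with corresponding partitions $A_1,\ldots,A_n$, then $\{A_1,\ldots,A_n\}$ (counted with multiplicity) is the branching data of $f$. *)

theory Defs
  imports "HOL-Analysis.Analysis" "HOL-Library.Multiset"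
begin

section \<open>Branched covers between surfaces\<close>

text \<open>
  Surfaces are subsets \<open>Y\<close>, \<open>X\<close> of topological spaces with the subspace topology. The
  definitions below are meant for compact, connected, orientable surfaces; these properties are
  not repeated there, and have to be provided by the concrete sets (such as spheres) to which
  the definitions are applied.
\<close>

definition locally_power_map ::
  "'a::topological_space set \<Rightarrow> 'b::topological_space set \<Rightarrow> ('a \<Rightarrow> 'b) \<Rightarrow> 'a \<Rightarrow> nat \<Rightarrow> bool" where
  "locally_power_map Y X f y m \<longleftrightarrow> m \<ge> 1 \<and>
     (\<exists>U V \<phi> \<phi>' \<psi> \<psi>'.
        openin (top_of_set Y) U \<and> y \<in> U \<and>
        openin (top_of_set X) V \<and> f ` U \<subseteq> V \<and>
        homeomorphism U (UNIV :: complex set) \<phi> \<phi>' \<and>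
        homeomorphism V (UNIV :: complex set) \<psi> \<psi>' \<and>
        \<phi> y = 0 \<and> \<psi> (f y) = 0 \<and>
        (\<forall>u\<in>U. \<psi> (f u) = \<phi> u ^ m))"

text \<open>Continuity of a branched cover on \<open>Y\<close> is implied by the local models.\<close>

definition branched_cover ::
  "'a::topological_space set \<Rightarrow> 'b::topological_space set \<Rightarrow> ('a \<Rightarrow> 'b) \<Rightarrow> bool" where
  "branched_cover Y X f \<longleftrightarrow> f ` Y = X \<and> (\<forall>y\<in>Y. \<exists>m. locally_power_map Y X f y m)"

definition local_degree ::
  "'a::topological_space set \<Rightarrow> 'b::topological_space set \<Rightarrow> ('a \<Rightarrow> 'b) \<Rightarrow> 'a \<Rightarrow> nat" where
  "local_degree Y X f y = (THE m. locally_power_map Y X f y m)"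

text \<open>
  The exponent of a local model is unique: a point close to \<open>f y\<close> has \<open>m\<close> preimages close to
  \<open>y\<close>, and these are distinct roots of order \<open>m'\<close> in any other local model.
\<close>

lemma locally_power_map_le:
  assumes "locally_power_map Y X f y m" "locally_power_map Y X f y m'"
  shows "m \<le> m'"
proof -
  from assms(1) obtain U V \<phi> \<phi>' \<psi> \<psi>' where m: "m \<ge> 1" and U: "openin (top_of_set Y) U" "y \<in> U"
    and fU: "f ` U \<subseteq> V"
    and \<phi>: "homeomorphism U (UNIV :: complex set) \<phi> \<phi>'"
    and \<psi>: "homeomorphism V (UNIV :: complex set) \<psi> \<psi>'"
    and zero: "\<phi> y = 0" "\<psi> (f y) = 0" and pow: "\<And>u. u \<in> U \<Longrightarrow> \<psi> (f u) = \<phi> u ^ m"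
    unfolding locally_power_map_def by blast
  from assms(2) obtain U2 V2 \<phi>2 \<phi>2' \<psi>2 \<psi>2' where m2: "m' \<ge> 1"
    and U2: "openin (top_of_set Y) U2" "y \<in> U2"
    and fU2: "f ` U2 \<subseteq> V2"
    and \<phi>2: "homeomorphism U2 (UNIV :: complex set) \<phi>2 \<phi>2'"
    and \<psi>2: "homeomorphism V2 (UNIV :: complex set) \<psi>2 \<psi>2'"
    and zero2: "\<phi>2 y = 0" "\<psi>2 (f y) = 0" and pow2: "\<And>u. u \<in> U2 \<Longrightarrow> \<psi>2 (f u) = \<phi>2 u ^ m'"
    unfolding locally_power_map_def by blast
  have "openin (top_of_set U) (U \<inter> U2)"
    using U(1) U2(1) by (metis inf.cobounded1 openin_Int openin_imp_subset openin_subset_trans)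
  then have "openin (top_of_set UNIV) (\<phi> ` (U \<inter> U2))"
    using homeomorphism_imp_open_map[OF \<phi>] by blast
  then have "open (\<phi> ` (U \<inter> U2))" by simp
  moreover have "0 \<in> \<phi> ` (U \<inter> U2)" using U(2) U2(2) zero(1) by force
  ultimately obtain r where r: "r > 0" "ball 0 r \<subseteq> \<phi> ` (U \<inter> U2)"
    by (meson openE)
  define w :: complex where "w = of_real (r / 2) ^ m"
  have w: "w \<noteq> 0" using r by (simp add: w_def)
  define Z where "Z = {z. z ^ m = w}"
  have cardZ: "card Z = m" unfolding Z_def using w m by (intro card_nth_roots) auto
  have normZ: "norm z < r" if "z \<in> Z" for z
  proof -
    have "norm z ^ m = norm (z ^ m)" by (simp only: norm_power)
    also have "\<dots> = (r / 2) ^ m"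
      using that r(1) unfolding Z_def w_def by (simp add: norm_power norm_divide)
    finally have "norm z = r / 2"
      by (rule power_eq_imp_eq_base) (use m r(1) in simp_all)
    then show ?thesis using r(1) by simp
  qed
  have in_UU: "\<phi>' z \<in> U \<inter> U2" "\<phi> (\<phi>' z) = z" if "z \<in> Z" for z
  proof -
    have "z \<in> ball 0 r" using normZ[OF that] by simp
    then obtain u where u: "u \<in> U" "u \<in> U2" "z = \<phi> u" using r(2) by blast
    then show "\<phi>' z \<in> U \<inter> U2" by (simp add: homeomorphism_apply1[OF \<phi>])
    show "\<phi> (\<phi>' z) = z" using homeomorphism_apply2[OF \<phi>] by blast
  qed
  define x where "x = \<psi>' w"
  have fx: "f (\<phi>' z) = x" if "z \<in> Z" for z
  proof -
    have "\<psi> (f (\<phi>' z)) = w" using in_UU[OF that] pow that by (auto simp: Z_def)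
    moreover have "f (\<phi>' z) \<in> V" using in_UU[OF that] fU by auto
    ultimately show ?thesis using homeomorphism_apply1[OF \<psi>] unfolding x_def by metis
  qed
  have "Z \<noteq> {}" using cardZ m by auto
  then obtain z0 where z0: "z0 \<in> Z" by blast
  have xV2: "x \<in> V2" using in_UU(1)[OF z0] fx[OF z0] fU2 by auto
  have "\<psi> x = w" using homeomorphism_apply2[OF \<psi>] by (simp add: x_def)
  then have "x \<noteq> f y" using zero w by auto
  moreover have "f y \<in> V2" using U2(2) fU2 by auto
  ultimately have nz: "\<psi>2 x \<noteq> 0" using xV2 zero2(2) homeomorphism_apply1[OF \<psi>2] by metis
  let ?R = "{z. z ^ m' = \<psi>2 x}"
  have "(\<phi>2 \<circ> \<phi>') ` Z \<subseteq> ?R"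
  proof safe
    fix z assume z: "z \<in> Z"
    have "\<psi>2 (f (\<phi>' z)) = \<phi>2 (\<phi>' z) ^ m'" using in_UU(1)[OF z] pow2 by blast
    then show "(\<phi>2 \<circ> \<phi>') z ^ m' = \<psi>2 x" by (simp add: fx[OF z])
  qed
  moreover have "inj_on (\<phi>2 \<circ> \<phi>') Z"
  proof (rule inj_onI)
    fix z1 z2 assume *: "z1 \<in> Z" "z2 \<in> Z" "(\<phi>2 \<circ> \<phi>') z1 = (\<phi>2 \<circ> \<phi>') z2"
    then have "\<phi>' z1 = \<phi>' z2"
      using in_UU(1)[OF *(1)] in_UU(1)[OF *(2)] homeomorphism_apply1[OF \<phi>2]
      by (metis IntD2 comp_apply)
    then show "z1 = z2" using in_UU(2)[OF *(1)] in_UU(2)[OF *(2)] by metis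
  qed
  moreover have "finite ?R" "card ?R = m'" using m2 nz by (auto intro!: card_nth_roots)
  ultimately show ?thesis using cardZ card_inj_on_le by metis
qed

lemma local_degree_eqI:
  assumes "locally_power_map Y X f y m"
  shows "local_degree Y X f y = m"
  unfolding local_degree_def
  using assms by (intro the_equality) (auto intro: antisym locally_power_map_le)

definition branch_points ::
  "'a::topological_space set \<Rightarrow> 'b::topological_space set \<Rightarrow> ('a \<Rightarrow> 'b) \<Rightarrow> 'b set" where
  "branch_points Y X f = {x \<in> X. \<exists>y\<in>Y. f y = x \<and> local_degree Y X f y > 1}"

text \<open>
  For a branched cover between compact surfaces, the fibres and the set of branch points are
  finite, so \<^const>\<open>mset_set\<close> lists each of their elements exactly once.
\<close>

definition fibre_partition ::
  "'a::topological_space set \<Rightarrow> 'b::topological_space set \<Rightarrow> ('a \<Rightarrow> 'b) \<Rightarrow> 'b \<Rightarrow> nat multiset" where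
  "fibre_partition Y X f x = {# local_degree Y X f y. y \<in># mset_set {y \<in> Y. f y = x} #}"

definition branching_data ::
  "'a::topological_space set \<Rightarrow> 'b::topological_space set \<Rightarrow> ('a \<Rightarrow> 'b) \<Rightarrow> nat multiset multiset" where
  "branching_data Y X f = {# fibre_partition Y X f x. x \<in># mset_set (branch_points Y X f) #}"

section \<open>Partitions\<close>

definition partition_of :: "nat \<Rightarrow> nat multiset \<Rightarrow> bool" where
  "partition_of d A \<longleftrightarrow> (\<forall>b\<in>#A. b > 0) \<and> sum_mset A = d"

definition nontrivial_partition :: "nat \<Rightarrow> nat multiset \<Rightarrow> bool" where
  "nontrivial_partition d A \<longleftrightarrow> partition_of d A \<and> (\<exists>b\<in>#A. b > 1)"

end

theory Submission
  imports Defs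
begin

text \<open>
  Move the first two branch points to the poles of the sphere. There the suspension
  \<open>sphere_power s\<close> of the power map \<open>\<omega> \<mapsto> \<omega>^s\<close> of the circle is a branched cover of the sphere by
  itself, totally ramified over the poles and \<open>s\<close> to one elsewhere. If all local degrees of \<open>f\<close>
  over the poles are divisible by \<open>s\<close>, then \<open>f\<close> factors through it: outside the preimages of the
  poles the horizontal coordinate of \<open>f\<close> is a nonvanishing complex function that has a continuous
  root of order \<open>s\<close> around every puncture, and on a punctured sphere these local roots
  glue to a global one. The factor \<open>h\<close> has degree \<open>d / s\<close> and the local degrees of \<open>f\<close> away from
  the preimages of the poles (\<open>ramified_sphere_map_root\<close>).

  Hence a collection \<open>Q\<close> of \<open>k\<close> points whose fibres consist of multiples of \<open>t\<close> can be traded, by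
  taking a root of order \<open>t\<close> branched at two of them, for a collection of \<open>(k - 2) * t\<close> such points,
  with the degree divided by \<open>t\<close>. If \<open>(k - 2) * t \<ge> k\<close> this can be repeated for ever, which is
  absurd (\<open>no_cover_with_many_divisible_fibres\<close>). This infinite descent takes the place of the
  Riemann-Hurwitz formula.

  In the theorem, one root of order \<open>s\<close> leaves a map of degree \<open>d'\<close> with \<open>s\<close> points, the preimages
  of the third branch point, whose fibres consist of multiples of \<open>t\<close>. So \<open>t\<close> divides \<open>d'\<close>,
  and the descent excludes \<open>s \<ge> 4, t \<ge> 2\<close> and \<open>s = 3, t \<ge> 3\<close>. For \<open>s = 3, t = 2\<close> a second
  root, of order two, leaves a map of degree \<open>d' / 2\<close> that has an even fibre, so \<open>4\<close> divides \<open>d'\<close>.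

  The only global invariant used is that the sum of the local degrees over a fibre is constant
  (\<open>fibre_sum_constant\<close>). From plane topology the proof takes invariance of domain and the existence
  of continuous logarithms on contractible sets, from which \<open>planar_root\<close> is built.
\<close>

section \<open>Topology of the sphere\<close>

lemma punctured_sphere_homeomorphic_plane:
  fixes b :: "'a::euclidean_space"
  assumes "DIM('a) = 3" "b \<in> sphere 0 1"
  shows "(sphere 0 1 - {b}) homeomorphic (UNIV :: complex set)"
  by (rule homeomorphic_punctured_sphere_affine) (use assms in auto)

text \<open>
  Invariance of domain in the plane, applied after stereographic projection. The centre of the
  projection must be missed by the map, so one point is removed from \<open>V\<close>; two different choices
  of that point cover \<open>V\<close>.
\<close>

lemma open_embedding_in_sphere_open_map:
  fixes \<alpha> :: "complex \<Rightarrow> 'a::euclidean_space"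
  assumes dim: "DIM('a) = 3" and V: "open V"
    and cont: "continuous_on V \<alpha>" and inj: "inj_on \<alpha> V" and im: "\<alpha> \<in> V \<rightarrow> sphere 0 1"
  shows "openin (top_of_set (sphere 0 1)) (\<alpha> ` V)"
proof -
  have punctured: "openin (top_of_set (sphere 0 1)) (\<alpha> ` (V - {z}))" if z: "z \<in> V" for z
  proof -
    let ?S = "sphere (0::'a) 1 - {\<alpha> z}"
    obtain \<theta> \<theta>' where \<theta>: "homeomorphism ?S (UNIV :: complex set) \<theta> \<theta>'"
      using punctured_sphere_homeomorphic_plane[OF dim, of "\<alpha> z"] im z
      unfolding homeomorphic_def by blast
    have sub: "\<alpha> ` (V - {z}) \<subseteq> ?S"
      using im inj z by (auto simp: inj_on_def Pi_iff)
    have inj_\<theta>: "inj_on \<theta> ?S"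
      using homeomorphism_apply1[OF \<theta>] by (rule inj_on_inverseI)
    have "open ((\<theta> \<circ> \<alpha>) ` (V - {z}))"
    proof (rule invariance_of_domain)
      show "continuous_on (V - {z}) (\<theta> \<circ> \<alpha>)"
        using sub cont homeomorphism_cont1[OF \<theta>]
        by (meson Diff_subset continuous_on_compose continuous_on_subset)
      show "inj_on (\<theta> \<circ> \<alpha>) (V - {z})"
        using inj_on_subset[OF inj Diff_subset] inj_on_subset[OF inj_\<theta> sub] by (rule comp_inj_on)
    qed (use V in auto)
    then have "openin (top_of_set ?S) (\<theta>' ` ((\<theta> \<circ> \<alpha>) ` (V - {z})))"
      using homeomorphism_imp_open_map[OF homeomorphism_symD[OF \<theta>]] by simp
    moreover have "\<theta>' ` ((\<theta> \<circ> \<alpha>) ` (V - {z})) = \<alpha> ` (V - {z})"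
      unfolding image_comp o_def
      using sub homeomorphism_apply1[OF \<theta>] by (intro image_cong) blast+
    ultimately have "openin (top_of_set ?S) (\<alpha> ` (V - {z}))" by (simp only:)
    then show ?thesis
      by (rule openin_trans) (intro openin_delete openin_subtopology_self)
  qed
  show ?thesis
  proof (cases "V = {}")
    case False
    then obtain z0 where z0: "z0 \<in> V" by auto
    have "V \<noteq> {z0}" using V not_open_singleton by blast
    then obtain z1 where z1: "z1 \<in> V" "z1 \<noteq> z0" using z0 by auto
    then have "\<alpha> ` V = \<alpha> ` (V - {z0}) \<union> \<alpha> ` (V - {z1})" by auto
    then show ?thesis
      using openin_Un[OF punctured[OF z0] punctured[OF z1(1)]] by simp
  qed auto
qed

lemma embedding_in_sphere_homeomorphism:
  fixes \<alpha> :: "complex \<Rightarrow> 'a::euclidean_space"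
  assumes "DIM('a) = 3" "open V" "continuous_on V \<alpha>" "inj_on \<alpha> V" "\<alpha> \<in> V \<rightarrow> sphere 0 1"
  obtains \<beta> where "homeomorphism V (\<alpha> ` V) \<alpha> \<beta>"
proof (rule homeomorphism_injective_open_map[OF assms(3) refl assms(4)])
  fix U assume "openin (top_of_set V) U"
  then have U: "open U" "U \<subseteq> V" using assms(2) by (auto simp: openin_open_eq)
  then have "openin (top_of_set (sphere 0 1)) (\<alpha> ` U)"
    using assms by (intro open_embedding_in_sphere_open_map)
      (auto intro: continuous_on_subset inj_on_subset)
  moreover have "\<alpha> ` U \<subseteq> \<alpha> ` V" "\<alpha> ` V \<subseteq> sphere 0 1" using U assms(5) by auto
  ultimately show "openin (top_of_set (\<alpha> ` V)) (\<alpha> ` U)"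
    using openin_subset_trans by blast
qed

lemma connected_sphere_minus_finite:
  fixes B :: "'a::euclidean_space set"
  assumes dim: "DIM('a) = 3" and B: "finite B"
  shows "connected (sphere 0 1 - B)"
proof (cases "sphere 0 1 \<inter> B = {}")
  case True
  then have "sphere 0 1 - B = sphere 0 1" by auto
  then show ?thesis using dim connected_sphere[of "0::'a" 1] by simp
next
  case False
  then obtain b where b: "b \<in> sphere 0 1" "b \<in> B" by auto
  obtain \<theta> \<theta>' where \<theta>: "homeomorphism (sphere 0 1 - {b}) (UNIV :: complex set) \<theta> \<theta>'"
    using punctured_sphere_homeomorphic_plane[OF dim b(1)] unfolding homeomorphic_def by blast
  have "connected (UNIV - \<theta> ` (B \<inter> sphere 0 1 - {b}))"
    using B by (intro connected_open_delete_finite) auto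
  then have "connected (\<theta>' ` (UNIV - \<theta> ` (B \<inter> sphere 0 1 - {b})))"
    using \<theta> by (intro connected_continuous_image) (auto intro: continuous_on_subset simp: homeomorphism_def)
  moreover have "\<theta>' ` (UNIV - \<theta> ` (B \<inter> sphere 0 1 - {b})) = sphere 0 1 - B"
  proof safe
    fix w assume w: "w \<notin> \<theta> ` (B \<inter> sphere 0 1 - {b})"
    have "\<theta>' w \<in> sphere 0 1 - {b}" "\<theta> (\<theta>' w) = w"
      using homeomorphism_image2[OF \<theta>] homeomorphism_apply2[OF \<theta>] by blast+
    then show "\<theta>' w \<in> sphere 0 1" "\<theta>' w \<in> B \<Longrightarrow> False"
      using w image_eqI[of w \<theta> "\<theta>' w"] by auto
  next
    fix x :: 'a assume x: "x \<in> sphere 0 1" "x \<notin> B"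
    then have "x \<in> sphere 0 1 - {b}" using b by auto
    then have "x = \<theta>' (\<theta> x)" by (rule homeomorphism_apply1[OF \<theta>, symmetric])
    moreover have "\<theta> x \<notin> \<theta> ` (B \<inter> sphere 0 1 - {b})"
    proof
      assume "\<theta> x \<in> \<theta> ` (B \<inter> sphere 0 1 - {b})"
      then obtain y where y: "y \<in> B" "y \<in> sphere 0 1 - {b}" "\<theta> x = \<theta> y" by blast
      moreover have "x \<in> sphere 0 1 - {b}" using x b by auto
      ultimately have "x = y" using homeomorphism_apply1[OF \<theta>] by metis
      then show False using x y by simp
    qed
    ultimately show "x \<in> \<theta>' ` (UNIV - \<theta> ` (B \<inter> sphere 0 1 - {b}))"
      by (intro image_eqI[of _ _ "\<theta> x"]) auto
  qed
  ultimately show ?thesis by simp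
qed

section \<open>Roots of nonvanishing functions\<close>

text \<open>
  The quotient takes values in the finite set of roots of unity.
\<close>

lemma continuous_roots_differ_by_constant:
  fixes h k :: "'a::topological_space \<Rightarrow> complex"
  assumes "connected S" "continuous_on S h" "continuous_on S k" and s: "s \<ge> 1"
    and pow: "\<And>x. x \<in> S \<Longrightarrow> h x ^ s = k x ^ s" and nz: "\<And>x. x \<in> S \<Longrightarrow> k x \<noteq> 0"
  obtains c where "c ^ s = 1" "\<And>x. x \<in> S \<Longrightarrow> h x = c * k x"
proof (cases "S = {}")
  case True
  then show ?thesis using that[of 1] by simp
next
  case False
  let ?q = "\<lambda>x. h x / k x"
  have roots: "?q x ^ s = 1" if "x \<in> S" for x
    using pow[OF that] nz[OF that] by (simp add: power_divide)
  have "?q constant_on S"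
  proof (rule continuous_finite_range_constant)
    show "continuous_on S ?q" using assms by (intro continuous_intros) auto
    have "finite {z::complex. z ^ s = 1}" using s by (intro finite_roots_unity) auto
    then show "finite (?q ` S)" by (rule rev_finite_subset) (use roots in blast)
  qed (rule assms(1))
  then obtain c where c: "\<And>x. x \<in> S \<Longrightarrow> ?q x = c" unfolding constant_on_def by blast
  show ?thesis
  proof (rule that)
    show "c ^ s = 1" using roots c False by auto
    show "h x = c * k x" if "x \<in> S" for x using c[OF that] nz[OF that] by (simp add: field_simps)
  qed
qed

text \<open>
  Pulled back along \<open>\<zeta> \<mapsto> p + exp \<zeta>\<close>, which is defined on a half-plane, \<open>u\<close> has a logarithm \<open>M\<close>. Going once
  around \<open>p\<close> changes \<open>M\<close> by a constant \<open>2 * pi * \<i> * n\<close>; subtracting \<open>n * \<zeta>\<close> makes it periodic, so that it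
  descends to the punctured disc.
\<close>

lemma punctured_disc_logarithm:
  fixes u :: "complex \<Rightarrow> complex"
  assumes cont: "continuous_on (ball p R - {p}) u" and nz: "\<And>z. z \<in> ball p R - {p} \<Longrightarrow> u z \<noteq> 0"
  obtains n :: int and L where "continuous_on (ball p R - {p}) L"
    "\<And>z. z \<in> ball p R - {p} \<Longrightarrow> u z = (z - p) powi n * exp (L z)"
proof (cases "R > 0")
  case False
  then have "ball p R = {}" by simp
  show ?thesis by (rule that[of "\<lambda>_. 0" 0]; unfold \<open>ball p R = {}\<close>; simp)
next
  case R: True
  \<comment> \<open>the preimage of the punctured disc under \<open>\<zeta> \<mapsto> p + exp \<zeta>\<close>\<close>
  define A where "A = {\<zeta>::complex. Re \<zeta> < ln R}"
  have A_iff: "\<zeta> \<in> A \<longleftrightarrow> p + exp \<zeta> \<in> ball p R - {p}" for \<zeta>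
    using R ln_less_cancel_iff[of "exp (Re \<zeta>)" R] by (simp add: A_def dist_norm)
  have "convex A" unfolding A_def by (rule convex_halfspace_Re_lt)
  have "open A" unfolding A_def by (rule open_halfspace_Re_lt)
  obtain M where contM: "continuous_on A M" and M: "\<And>\<zeta>. \<zeta> \<in> A \<Longrightarrow> u (p + exp \<zeta>) = exp (M \<zeta>)"
  proof (rule continuous_logarithm_on_contractible[of A "\<lambda>\<zeta>. u (p + exp \<zeta>)"])
    show "continuous_on A (\<lambda>\<zeta>. u (p + exp \<zeta>))"
      by (rule continuous_on_compose2[OF cont]) (auto intro!: continuous_intros simp: A_iff)
    show "contractible A" by (rule convex_imp_contractible) fact
    show "u (p + exp \<zeta>) \<noteq> 0" if "\<zeta> \<in> A" for \<zeta> using that nz A_iff by blast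
  qed blast
  define \<tau> where "\<tau> = 2 * complex_of_real pi * \<i>"
  have \<tau>: "exp (\<zeta> + \<tau>) = exp \<zeta>" "\<zeta> + \<tau> \<in> A \<longleftrightarrow> \<zeta> \<in> A" for \<zeta>
    by (simp_all add: \<tau>_def exp_add A_def)
  have \<tau>nz: "\<tau> \<noteq> 0" by (simp add: \<tau>_def)
  let ?q = "\<lambda>\<zeta>. (M (\<zeta> + \<tau>) - M \<zeta>) / \<tau>"
  have qint: "?q \<zeta> \<in> \<int>" if "\<zeta> \<in> A" for \<zeta>
  proof -
    have "exp (M (\<zeta> + \<tau>)) = exp (M \<zeta>)"
      using M[of \<zeta>] M[of "\<zeta> + \<tau>"] \<tau> that by simp
    then obtain k :: int where "M (\<zeta> + \<tau>) = M \<zeta> + of_int (2 * k) * pi * \<i>"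
      by (auto simp: exp_eq)
    then have "?q \<zeta> = of_int k" using \<tau>nz by (simp add: \<tau>_def field_simps)
    then show ?thesis by simp
  qed
  have "?q constant_on A"
  proof (rule continuous_discrete_range_constant)
    show "connected A" using \<open>convex A\<close> by (rule convex_connected)
    show "continuous_on A ?q"
      using contM \<tau> \<tau>nz by (intro continuous_intros continuous_on_compose2[OF contM]) auto
    show "\<exists>e>0. \<forall>y. y \<in> A \<and> ?q y \<noteq> ?q x \<longrightarrow> e \<le> norm (?q y - ?q x)" if "x \<in> A" for x
    proof (intro exI[of _ 1] conjI allI impI)
      fix y assume y: "y \<in> A \<and> ?q y \<noteq> ?q x"
      then obtain i j :: int where "?q y = of_int i" "?q x = of_int j"
        using qint \<open>x \<in> A\<close> by (metis Ints_cases)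
      moreover from this have "i \<noteq> j" using y by auto
      ultimately show "1 \<le> norm (?q y - ?q x)"
        by (metis norm_of_int of_int_diff of_int_1_le_iff of_int_abs right_minus_eq int_one_le_iff_zero_less zero_less_abs_iff)
    qed simp
  qed
  then obtain c where c: "\<And>\<zeta>. \<zeta> \<in> A \<Longrightarrow> ?q \<zeta> = c" unfolding constant_on_def by blast
  have "of_real (ln R - 1) \<in> A" by (simp add: A_def)
  then obtain n :: int where n: "c = of_int n" using c qint by (metis Ints_cases)
  define N where "N \<zeta> = M \<zeta> - of_int n * \<zeta>" for \<zeta>
  have N1: "N (\<zeta> + \<tau>) = N \<zeta>" if "\<zeta> \<in> A" for \<zeta>
    using c[OF that] \<tau>nz by (simp add: N_def n field_simps)
  have N2: "N (\<zeta> + of_nat k * \<tau>) = N \<zeta> \<and> \<zeta> + of_nat k * \<tau> \<in> A" if "\<zeta> \<in> A" for \<zeta> k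
  proof (induction k)
    case (Suc k)
    have "\<zeta> + of_nat (Suc k) * \<tau> = (\<zeta> + of_nat k * \<tau>) + \<tau>" by (simp add: algebra_simps)
    then show ?case using Suc N1 \<tau>(2) by metis
  qed (use that in simp)
  have N3: "N \<zeta> = N \<xi>" if \<zeta>: "\<zeta> \<in> A" and \<xi>: "\<xi> \<in> A" and e: "exp \<zeta> = exp \<xi>" for \<zeta> \<xi>
  proof -
    obtain k :: int where "\<zeta> = \<xi> + of_int (2 * k) * pi * \<i>" using e by (auto simp: exp_eq)
    then have k: "\<zeta> = \<xi> + of_int k * \<tau>" by (simp add: \<tau>_def)
    show ?thesis
    proof (cases "k \<ge> 0")
      case True
      then have "\<zeta> = \<xi> + of_nat (nat k) * \<tau>" using k by simp
      then show ?thesis using N2[OF \<xi>] by simp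
    next
      case False
      then have "\<xi> = \<zeta> + of_nat (nat (- k)) * \<tau>" using k by simp
      then show ?thesis using N2[OF \<zeta>, of "nat (- k)"] by simp
    qed
  qed
  have contN: "continuous_on A N" unfolding N_def by (intro continuous_intros contM)
  \<comment> \<open>by periodicity the choice of the branch of the logarithm does not matter\<close>
  define L where "L z = N (Ln (z - p))" for z
  have Leq: "L (p + exp \<zeta>) = N \<zeta>" if "\<zeta> \<in> A" for \<zeta>
  proof -
    have "exp (Ln (exp \<zeta>)) = exp \<zeta>" by simp
    then have "Ln (exp \<zeta>) \<in> A" using that A_iff by metis
    from N3[OF this that] show ?thesis by (simp add: L_def)
  qed
  show ?thesis
  proof (rule that)
    show "continuous_on (ball p R - {p}) L"
    proof (rule continuous_at_imp_continuous_on, rule ballI)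
      fix z0 assume z0: "z0 \<in> ball p R - {p}"
      \<comment> \<open>a branch of the logarithm without discontinuity at \<open>z0\<close>\<close>
      define b where "b z = Ln (z0 - p) + Ln ((z - p) / (z0 - p))" for z
      have z0': "z0 - p \<noteq> 0" using z0 by simp
      have expb: "p + exp (b z) = z" if "z \<noteq> p" for z
        using that z0' by (simp add: b_def exp_add)
      have cb: "isCont b z0"
        unfolding b_def using z0' by (intro continuous_intros) auto
      have "b z0 \<in> A" using A_iff[of "b z0"] expb[of z0] z0 by auto
      then have "isCont N (b z0)" using contN \<open>open A\<close> by (simp add: continuous_on_eq_continuous_at)
      then have "isCont (\<lambda>z. N (b z)) z0" using cb by (rule isCont_o2[rotated])
      moreover have "\<forall>\<^sub>F z in nhds z0. N (b z) = L z"
      proof (rule eventually_nhds_in_open[THEN eventually_mono])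
        show "open (ball p R - {p})" by (intro open_delete open_ball)
        fix z assume z: "z \<in> ball p R - {p}"
        then have "p + exp (b z) = z" using expb by auto
        then show "N (b z) = L z" using Leq[of "b z"] A_iff[of "b z"] z by simp
      qed (rule z0)
      ultimately show "isCont L z0" using isCont_cong by fast
    qed
    fix z assume z: "z \<in> ball p R - {p}"
    define \<zeta> where "\<zeta> = Ln (z - p)"
    have e: "exp \<zeta> = z - p" using z by (simp add: \<zeta>_def)
    then have \<zeta>: "\<zeta> \<in> A" using z A_iff[of \<zeta>] by simp
    have "u z = exp (M \<zeta>)" using M[OF \<zeta>] e by simp
    also have "M \<zeta> = of_int n * \<zeta> + L z" by (simp add: N_def L_def \<zeta>_def)
    also have "exp (of_int n * \<zeta> + L z) = (z - p) powi n * exp (L z)"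
      using exp_power_int[of \<zeta> n] by (simp add: exp_add e)
    finally show "u z = (z - p) powi n * exp (L z)" .
  qed
qed

lemma continuous_on_closed_cases:
  assumes "closedin (top_of_set U) S" "closedin (top_of_set U) T" "U = S \<union> T"
    and "continuous_on S f" "continuous_on T g"
    and "\<And>x. x \<in> S \<Longrightarrow> x \<in> T \<Longrightarrow> f x = g x"
  shows "continuous_on U (\<lambda>x. if x \<in> S then f x else g x)"
proof -
  have "continuous_on (S \<union> T) (\<lambda>x. if x \<in> S then f x else g x)"
    by (rule continuous_on_cases_local) (use assms in auto)
  then show ?thesis using assms(3) by simp
qed

text \<open>
  Roots around the punctures glue to a global root because the plane is simply connected. The
  induction fills in one puncture \<open>p\<close> at a time: after division by the power \<open>s\<close> of some
  \<open>Q z = (z - p)^n\<close>, the function \<open>F\<close> has a logarithm on a circle around \<open>p\<close>, hence its values inside that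
  circle can be replaced by an exponential that is defined at \<open>p\<close>, too. The root of the modified
  function that the induction hypothesis provides is then matched along the circle with the given
  root around \<open>p\<close>.
\<close>

lemma planar_root:
  fixes F :: "complex \<Rightarrow> complex"
  assumes "finite K" and s: "s \<ge> 1"
    and "continuous_on (- K) F" "\<And>z. z \<notin> K \<Longrightarrow> F z \<noteq> 0"
    and "\<And>p. p \<in> K \<Longrightarrow> \<exists>R>0. \<exists>H. continuous_on (ball p R - {p}) H \<and>
           (\<forall>z\<in>ball p R - {p}. F z = H z ^ s)"
  shows "\<exists>G. continuous_on (- K) G \<and> (\<forall>z\<in>- K. G z ^ s = F z)"
  using assms(1,3-)
proof (induction K arbitrary: F rule: finite_induct)
  case empty
  have "continuous_on UNIV F" using empty by simp
  moreover have "contractible (UNIV :: complex set)" by (intro convex_imp_contractible convex_UNIV)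
  moreover have "F z \<noteq> 0" for z using empty by simp
  ultimately obtain l where l: "continuous_on UNIV l" "\<And>z. F z = exp (l z)"
    using continuous_logarithm_on_contractible[of UNIV F] by (metis UNIV_I)
  have "continuous_on (- {}) (\<lambda>z. exp (l z / of_nat s))"
    using l s by (auto intro!: continuous_intros)
  moreover have "exp (l z / of_nat s) ^ s = F z" for z
    using s l by (simp flip: exp_of_nat_mult)
  ultimately show ?case by blast
next
  case (insert p K)
  obtain R H where R: "R > 0" and contH: "continuous_on (ball p R - {p}) H"
    and H: "\<And>z. z \<in> ball p R - {p} \<Longrightarrow> F z = H z ^ s"
    using insert.prems(3)[of p] by blast
  have "open (- K)" using insert.hyps(1) by (simp add: finite_imp_closed open_Compl)
  then obtain \<rho> where \<rho>: "\<rho> > 0" "ball p \<rho> \<subseteq> - K" using insert.hyps(2) by (meson ComplI openE)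
  define r where "r = min R \<rho> / 2"
  have r: "r > 0" "r < R" "r < \<rho>" using R \<rho> by (auto simp: r_def)
  have rK: "cball p r \<inter> K = {}" using \<rho>(2) r by (fastforce simp: subset_iff)
  have Fnz: "F z \<noteq> 0" if "z \<in> ball p (min R \<rho>) - {p}" for z
    using insert.prems(2)[of z] \<rho>(2) that by auto
  obtain n L where contL: "continuous_on (ball p (min R \<rho>) - {p}) L"
    and L: "\<And>z. z \<in> ball p (min R \<rho>) - {p} \<Longrightarrow> H z = (z - p) powi n * exp (L z)"
  proof (rule punctured_disc_logarithm)
    show "continuous_on (ball p (min R \<rho>) - {p}) H"
      by (rule continuous_on_subset[OF contH]) auto
    show "H z \<noteq> 0" if "z \<in> ball p (min R \<rho>) - {p}" for z
      using Fnz[OF that] H[of z] that s by auto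
  qed blast
  have contL': "continuous_on (sphere p r) L"
    by (rule continuous_on_subset[OF contL]) (use r in auto)
  \<comment> \<open>the logarithm on the circle, extended across the disc\<close>
  obtain E where contE: "continuous_on UNIV E" and E: "\<And>z. z \<in> sphere p r \<Longrightarrow> E z = L z"
    using Tietze_unbounded[OF contL', of UNIV] by (auto simp: closed_sphere)
  define Q where "Q z = (z - p) powi n" for z
  have contQ: "continuous_on (- {p}) Q"
    unfolding Q_def by (auto intro!: continuous_intros)
  have Qnz: "Q z \<noteq> 0" if "z \<noteq> p" for z using that by (simp add: Q_def)
  let ?T = "- K - ball p r"
  have clT: "closedin (top_of_set (- K)) ?T" "closedin (top_of_set (- insert p K)) ?T"
  proof -
    have "?T = (- K) \<inter> (- ball p r)" "?T = (- insert p K) \<inter> (- ball p r)" using r by auto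
    then show "closedin (top_of_set (- K)) ?T" "closedin (top_of_set (- insert p K)) ?T"
      by (metis closed_Compl closedin_closed_Int open_ball)+
  qed
  have clS: "closedin (top_of_set (- K)) (cball p r)"
    "closedin (top_of_set (- insert p K)) (cball p r - {p})"
  proof -
    have "cball p r = (- K) \<inter> cball p r" "cball p r - {p} = (- insert p K) \<inter> cball p r"
      using rK by auto
    then show "closedin (top_of_set (- K)) (cball p r)"
      "closedin (top_of_set (- insert p K)) (cball p r - {p})"
      by (metis closed_cball closedin_closed_Int)+
  qed
  have circle: "z \<in> sphere p r" if "z \<in> cball p r" "z \<in> ?T" for z using that by auto
  define F' where "F' z = (if z \<in> cball p r then exp (of_nat s * E z) else F z / Q z ^ s)" for z
  have "\<exists>G. continuous_on (- K) G \<and> (\<forall>z\<in>- K. G z ^ s = F' z)"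
  proof (rule insert.IH)
    show "continuous_on (- K) F'"
      unfolding F'_def
    proof (rule continuous_on_closed_cases[OF clS(1) clT(1)])
      show "- K = cball p r \<union> ?T" using rK by auto
      show "continuous_on (cball p r) (\<lambda>z. exp (of_nat s * E z))"
        by (intro continuous_intros continuous_on_subset[OF contE]) auto
      have "?T \<subseteq> - insert p K" "?T \<subseteq> - {p}" using r by auto
      then show "continuous_on ?T (\<lambda>z. F z / Q z ^ s)"
        using Qnz by (intro continuous_intros continuous_on_subset[OF insert.prems(1)]
            continuous_on_subset[OF contQ]) auto
      fix z assume "z \<in> cball p r" "z \<in> ?T"
      then have z: "z \<in> sphere p r" by (rule circle)
      then have "F z = (Q z * exp (L z)) ^ s" using H[of z] L[of z] r by (auto simp: Q_def)
      moreover have "Q z \<noteq> 0" using z r Qnz[of z] by auto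
      ultimately show "exp (of_nat s * E z) = F z / Q z ^ s"
        using E[OF z] by (simp add: power_mult_distrib exp_of_nat_mult)
    qed
    show "F' z \<noteq> 0" if "z \<notin> K" for z
      using that insert.prems(2)[of z] Qnz[of z] r by (cases "z = p") (auto simp: F'_def)
    fix k assume k: "k \<in> K"
    then obtain R1 H1 where 1: "R1 > 0" "continuous_on (ball k R1 - {k}) H1"
       "\<forall>z\<in>ball k R1 - {k}. F z = H1 z ^ s"
      using insert.prems(3)[of k] by blast
    have "open (- cball p r)" "k \<in> - cball p r" using k rK by auto
    then obtain R2 where 2: "R2 > 0" "ball k R2 \<subseteq> - cball p r" by (meson openE)
    show "\<exists>R>0. \<exists>H. continuous_on (ball k R - {k}) H \<and> (\<forall>z\<in>ball k R - {k}. F' z = H z ^ s)"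
    proof (intro exI[of _ "min R1 R2"] conjI exI[of _ "\<lambda>z. H1 z / Q z"] ballI)
      have sub: "ball k (min R1 R2) - {k} \<subseteq> - {p}" using 2 r by auto
      then have "\<forall>z\<in>ball k (min R1 R2) - {k}. Q z \<noteq> 0" using Qnz by blast
      then show "continuous_on (ball k (min R1 R2) - {k}) (\<lambda>z. H1 z / Q z)"
        using sub by (intro continuous_on_divide continuous_on_subset[OF 1(2)]
            continuous_on_subset[OF contQ]) auto
      fix z assume z: "z \<in> ball k (min R1 R2) - {k}"
      then have "z \<notin> cball p r" using 2 by auto
      moreover have "F z = H1 z ^ s" using 1 z by auto
      ultimately show "F' z = (H1 z / Q z) ^ s" by (simp add: F'_def power_divide)
    qed (use 1 2 in auto)
  qed
  then obtain G' where contG': "continuous_on (- K) G'" and G': "\<And>z. z \<in> - K \<Longrightarrow> G' z ^ s = F' z"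
    by blast
  \<comment> \<open>\<open>G'\<close> solves the problem outside the disc, up to the factor that was divided out\<close>
  have out: "(G' z * Q z) ^ s = F z" if "z \<in> ?T" for z
  proof (cases "z \<in> cball p r")
    case True
    with that have z: "z \<in> sphere p r" by (intro circle)
    then have "F z = (Q z * exp (L z)) ^ s" using H[of z] L[of z] r by (auto simp: Q_def)
    moreover have "F' z = exp (L z) ^ s" using True E[OF z] by (simp add: F'_def exp_of_nat_mult)
    moreover have "z \<in> - K" using that by simp
    ultimately show ?thesis using G'[of z] by (simp add: power_mult_distrib)
  next
    case False
    then have "Q z \<noteq> 0" using Qnz[of z] r by (cases "z = p") auto
    then show ?thesis using False that G'[of z] by (simp add: F'_def power_mult_distrib)
  qed
  have T_sub: "?T \<subseteq> - {p}" "sphere p r \<subseteq> ?T" "sphere p r \<subseteq> ball p R - {p}"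
    using r rK by auto
  obtain c where c: "c ^ s = 1" "\<And>z. z \<in> sphere p r \<Longrightarrow> G' z * Q z = c * H z"
  proof (rule continuous_roots_differ_by_constant[of "sphere p r" "\<lambda>z. G' z * Q z" H s])
    show "connected (sphere p r)" by (intro connected_sphere) simp
    show "continuous_on (sphere p r) (\<lambda>z. G' z * Q z)"
      using T_sub by (intro continuous_intros continuous_on_subset[OF contG']
          continuous_on_subset[OF contQ]) auto
    show "continuous_on (sphere p r) H" using T_sub by (intro continuous_on_subset[OF contH])
    fix z assume z: "z \<in> sphere p r"
    show "(G' z * Q z) ^ s = H z ^ s" 
      using out[OF subsetD[OF T_sub(2) z]] H[OF subsetD[OF T_sub(3) z]] by simp
    show "H z \<noteq> 0" using L[of z] z r by auto
  qed (use s in blast)+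
  define G where "G z = (if z \<in> cball p r - {p} then c * H z else G' z * Q z)" for z
  show ?case
  proof (intro exI[of _ G] conjI ballI)
    show "continuous_on (- insert p K) G"
      unfolding G_def
    proof (rule continuous_on_closed_cases[OF clS(2) clT(2)])
      show "- insert p K = (cball p r - {p}) \<union> ?T" using rK r by auto
      show "continuous_on (cball p r - {p}) (\<lambda>z. c * H z)"
        using r by (intro continuous_intros continuous_on_subset[OF contH]) auto
      show "continuous_on ?T (\<lambda>z. G' z * Q z)"
        using T_sub by (intro continuous_intros continuous_on_subset[OF contG']
          continuous_on_subset[OF contQ]) auto
      show "c * H z = G' z * Q z" if "z \<in> cball p r - {p}" "z \<in> ?T" for z
        using c(2)[of z] circle[of z] that by simp
    qed
    fix z assume z: "z \<in> - insert p K"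
    show "G z ^ s = F z"
    proof (cases "z \<in> cball p r - {p}")
      case True
      then have "z \<in> ball p R - {p}" using r by auto
      then show ?thesis using True H[of z] c(1) by (simp add: G_def power_mult_distrib)
    next
      case False
      then have "z \<in> ?T" using z by auto
      then show ?thesis using False out by (auto simp: G_def)
    qed
  qed
qed

section \<open>Local power models and the degree\<close>

text \<open>
  A model of \<open>f\<close> around \<open>y\<close> as the power map of exponent \<open>m\<close>, given by parametrisations of
  neighbourhoods of \<open>y\<close> and \<open>f y\<close> instead of charts. On a sphere, the images of \<open>\<alpha>\<close> and \<open>\<kappa>\<close> are open by
  invariance of domain, so openness is left out; this keeps models of lifted maps easy to build.
\<close>

definition power_chart ::
  "'a::topological_space set \<Rightarrow> 'b::topological_space set \<Rightarrow> ('a \<Rightarrow> 'b) \<Rightarrow> 'a \<Rightarrow> nat \<Rightarrow>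
    (complex \<Rightarrow> 'a) \<Rightarrow> (complex \<Rightarrow> 'b) \<Rightarrow> bool" where
  "power_chart Y X f y m \<alpha> \<kappa> \<longleftrightarrow> m \<ge> 1 \<and>
     continuous_on (ball 0 1) \<alpha> \<and> inj_on \<alpha> (ball 0 1) \<and> \<alpha> \<in> ball 0 1 \<rightarrow> Y \<and> \<alpha> 0 = y \<and>
     continuous_on (ball 0 1) \<kappa> \<and> inj_on \<kappa> (ball 0 1) \<and> \<kappa> \<in> ball 0 1 \<rightarrow> X \<and>
     (\<forall>z\<in>ball 0 1. f (\<alpha> z) = \<kappa> (z ^ m))"

definition power_model ::
  "'a::topological_space set \<Rightarrow> 'b::topological_space set \<Rightarrow> ('a \<Rightarrow> 'b) \<Rightarrow> 'a \<Rightarrow> nat \<Rightarrow> bool" where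
  "power_model Y X f y m \<longleftrightarrow> (\<exists>\<alpha> \<kappa>. power_chart Y X f y m \<alpha> \<kappa>)"

lemma power_chartD:
  assumes "power_chart Y X f y m \<alpha> \<kappa>"
  shows "m \<ge> 1" "continuous_on (ball 0 1) \<alpha>" "inj_on \<alpha> (ball 0 1)" "\<alpha> \<in> ball 0 1 \<rightarrow> Y" "\<alpha> 0 = y"
    "continuous_on (ball 0 1) \<kappa>" "inj_on \<kappa> (ball 0 1)" "\<kappa> \<in> ball 0 1 \<rightarrow> X"
    "\<And>z. z \<in> ball 0 1 \<Longrightarrow> f (\<alpha> z) = \<kappa> (z ^ m)"
  using assms unfolding power_chart_def by auto

lemma norm_power_less_one:
  fixes z :: "'a::real_normed_div_algebra"
  assumes "m \<ge> 1" "norm z < 1"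
  shows "norm (z ^ m) < 1"
  using assms by (simp add: norm_power power_less_one_iff)

lemma power_chart_centre:
  assumes "power_chart Y X f y m \<alpha> \<kappa>"
  shows "f y = \<kappa> 0"
  using power_chartD(9)[OF assms, of 0] power_chartD(1,5)[OF assms] by (simp add: power_0_left)

text \<open>
  Rescaling the discs by \<open>\<rho>\<close> and \<open>\<rho> ^ m\<close> commutes with the power map.
\<close>

lemma power_modelI_small_disc:
  fixes \<alpha> :: "complex \<Rightarrow> 'a::topological_space" and \<kappa> :: "complex \<Rightarrow> 'b::topological_space"
  assumes m: "m \<ge> 1" and \<rho>: "0 < \<rho>" "\<rho> \<le> 1"
    and \<alpha>: "continuous_on (ball 0 \<rho>) \<alpha>" "inj_on \<alpha> (ball 0 \<rho>)" "\<alpha> \<in> ball 0 \<rho> \<rightarrow> Y" "\<alpha> 0 = y"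
    and \<kappa>: "continuous_on (ball 0 \<rho>) \<kappa>" "inj_on \<kappa> (ball 0 \<rho>)" "\<kappa> \<in> ball 0 \<rho> \<rightarrow> X"
    and f: "\<And>z. z \<in> ball 0 \<rho> \<Longrightarrow> f (\<alpha> z) = \<kappa> (z ^ m)"
  shows "power_model Y X f y m"
proof -
  have scale: "of_real c * z \<in> ball 0 \<rho>" if "z \<in> ball (0::complex) 1" "0 < c" "c \<le> \<rho>" for z c
  proof -
    have "c * norm z < c" using that by simp
    then have "c * norm z < \<rho>" using that by linarith
    then show ?thesis using that by (simp add: norm_mult)
  qed
  have \<rho>m: "0 < \<rho> ^ m" "\<rho> ^ m \<le> \<rho>"
    using \<rho> m by (auto simp: power_le_one intro: power_decreasing[of 1 m \<rho>, simplified])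
  have scale1: "of_real \<rho> * z \<in> ball 0 \<rho>" if "z \<in> ball (0::complex) 1" for z
    using scale[OF that] \<rho> by simp
  have scale2: "of_real (\<rho> ^ m) * z \<in> ball 0 \<rho>" if "z \<in> ball (0::complex) 1" for z
    using scale[OF that \<rho>m] .
  have "power_chart Y X f y m (\<lambda>z. \<alpha> (of_real \<rho> * z)) (\<lambda>v. \<kappa> (of_real (\<rho> ^ m) * v))"
    unfolding power_chart_def
  proof (intro conjI ballI)
    show "continuous_on (ball 0 1) (\<lambda>z. \<alpha> (of_real \<rho> * z))"
      by (rule continuous_on_compose2[OF \<alpha>(1)]) (auto intro!: continuous_intros scale1 simp del: mem_ball)
    show "continuous_on (ball 0 1) (\<lambda>v. \<kappa> (of_real (\<rho> ^ m) * v))"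
      by (rule continuous_on_compose2[OF \<kappa>(1)]) (auto intro!: continuous_intros scale2 simp del: of_real_power mem_ball)
    show "inj_on (\<lambda>z. \<alpha> (of_real \<rho> * z)) (ball 0 1)"
    proof (rule inj_onI)
      fix z w assume zw: "z \<in> ball (0::complex) 1" "w \<in> ball (0::complex) 1"
        "\<alpha> (of_real \<rho> * z) = \<alpha> (of_real \<rho> * w)"
      then have "of_real \<rho> * z = of_real \<rho> * w"
        by (intro inj_onD[OF \<alpha>(2)] scale1)
      then show "z = w" using \<rho> by simp
    qed
    show "inj_on (\<lambda>z. \<kappa> (of_real (\<rho> ^ m) * z)) (ball 0 1)"
    proof (rule inj_onI)
      fix z w assume zw: "z \<in> ball (0::complex) 1" "w \<in> ball (0::complex) 1"
        "\<kappa> (of_real (\<rho> ^ m) * z) = \<kappa> (of_real (\<rho> ^ m) * w)"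
      then have "of_real (\<rho> ^ m) * z = of_real (\<rho> ^ m) * w"
        by (intro inj_onD[OF \<kappa>(2)] scale2)
      then show "z = w" using \<rho>m by simp
    qed
    show "(\<lambda>z. \<alpha> (of_real \<rho> * z)) \<in> ball 0 1 \<rightarrow> Y" using \<alpha>(3) scale1 by (simp add: Pi_iff)
    show "(\<lambda>z. \<kappa> (of_real (\<rho> ^ m) * z)) \<in> ball 0 1 \<rightarrow> X" using \<kappa>(3) scale2 by (simp add: Pi_iff)
    show "f (\<alpha> (of_real \<rho> * z)) = \<kappa> (of_real (\<rho> ^ m) * z ^ m)" if "z \<in> ball 0 1" for z
      using f[OF scale1[OF that]] by (simp add: power_mult_distrib)
  qed (use m \<alpha> in auto)
  then show ?thesis unfolding power_model_def by blast
qed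

lemma locally_power_map_imp_power_model:
  assumes "locally_power_map Y X f y m"
  shows "power_model Y X f y m"
proof -
  obtain U V \<phi> \<phi>' \<psi> \<psi>' where m: "m \<ge> 1" and U: "openin (top_of_set Y) U" "y \<in> U"
    and V: "openin (top_of_set X) V" and fU: "f ` U \<subseteq> V"
    and \<phi>: "homeomorphism U (UNIV :: complex set) \<phi> \<phi>'"
    and \<psi>: "homeomorphism V (UNIV :: complex set) \<psi> \<psi>'"
    and zero: "\<phi> y = 0" and pow: "\<And>u. u \<in> U \<Longrightarrow> \<psi> (f u) = \<phi> u ^ m"
    using assms unfolding locally_power_map_def by blast
  have \<phi>'U: "\<phi>' z \<in> U" "\<phi> (\<phi>' z) = z" for z
    using homeomorphism_image2[OF \<phi>] homeomorphism_apply2[OF \<phi>] by blast+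
  have \<psi>'V: "\<psi>' z \<in> V" "\<psi> (\<psi>' z) = z" for z
    using homeomorphism_image2[OF \<psi>] homeomorphism_apply2[OF \<psi>] by blast+
  show ?thesis
  proof (rule power_modelI_small_disc[of m 1 \<phi>' Y y \<psi>'])
    show "continuous_on (ball 0 1) \<phi>'" "continuous_on (ball 0 1) \<psi>'"
      using homeomorphism_cont2[OF \<phi>] homeomorphism_cont2[OF \<psi>] by (auto intro: continuous_on_subset)
    show "inj_on \<phi>' (ball 0 1)" using \<phi>'U(2) by (rule inj_on_inverseI)
    show "inj_on \<psi>' (ball 0 1)" using \<psi>'V(2) by (rule inj_on_inverseI)
    show "\<phi>' \<in> ball 0 1 \<rightarrow> Y" using \<phi>'U(1) openin_imp_subset[OF U(1)] by blast
    show "\<psi>' \<in> ball 0 1 \<rightarrow> X" using \<psi>'V(1) openin_imp_subset[OF V(1)] by blast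
    show "\<phi>' 0 = y" using homeomorphism_apply1[OF \<phi> U(2)] zero by simp
    fix z :: complex
    have "\<psi> (f (\<phi>' z)) = z ^ m" using pow[OF \<phi>'U(1)] \<phi>'U(2) by simp
    moreover have "f (\<phi>' z) \<in> V" using fU \<phi>'U(1) by blast
    ultimately show "f (\<phi>' z) = \<psi>' (z ^ m)" using homeomorphism_apply1[OF \<psi>] by metis
  qed (use m in auto)
qed

lemma branched_cover_continuous_on:
  fixes Y :: "'a::t2_space set"
  assumes "branched_cover Y X f"
  shows "continuous_on Y f"
  unfolding continuous_on_eq_continuous_within
proof
  fix y assume y: "y \<in> Y"
  then obtain m where "locally_power_map Y X f y m" using assms unfolding branched_cover_def by blast
  then obtain U V \<phi> \<phi>' \<psi> \<psi>' where U: "openin (top_of_set Y) U" "y \<in> U"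
    and fU: "f ` U \<subseteq> V"
    and \<phi>: "homeomorphism U (UNIV :: complex set) \<phi> \<phi>'"
    and \<psi>: "homeomorphism V (UNIV :: complex set) \<psi> \<psi>'"
    and pow: "\<And>u. u \<in> U \<Longrightarrow> \<psi> (f u) = \<phi> u ^ m"
    unfolding locally_power_map_def by blast
  have eq: "f u = \<psi>' (\<phi> u ^ m)" if "u \<in> U" for u
    using homeomorphism_apply1[OF \<psi>, of "f u"] pow[OF that] fU that by auto
  have "continuous_on U (\<lambda>u. \<psi>' (\<phi> u ^ m))"
    by (rule continuous_on_compose2[OF homeomorphism_cont2[OF \<psi>]])
      (auto intro!: continuous_intros homeomorphism_cont1[OF \<phi>])
  then have "continuous_on U f" using eq by (simp cong: continuous_on_cong)
  then have "continuous (at y within U) f" using U(2) by (simp add: continuous_on_eq_continuous_within)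
  moreover obtain T where "open T" "U = Y \<inter> T" using U(1) by (auto simp: openin_open)
  then have "at y within U = at y within Y" using U(2) by (intro at_within_nhd[of y T]) auto
  ultimately show "continuous (at y within Y) f" by simp
qed

text \<open>
  For \<open>m \<ge> 2\<close> a nontrivial root of unity \<open>\<zeta>\<close> of order \<open>m\<close> would give the points \<open>\<alpha> w\<close> and \<open>\<alpha> (\<zeta> * w)\<close>
  arbitrarily close to \<open>y\<close> with the same image.
\<close>

lemma power_model_one_if_locally_injective:
  assumes "power_model Y X f y m" "openin (top_of_set Y) U" "y \<in> U" "inj_on f U"
  shows "m = 1"
proof (rule ccontr)
  assume "m \<noteq> 1"
  obtain \<alpha> \<kappa> where c: "power_chart Y X f y m \<alpha> \<kappa>" using assms(1) unfolding power_model_def by blast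
  note C = power_chartD[OF c]
  have "m \<ge> 2" using \<open>m \<noteq> 1\<close> C(1) by simp
  then have "card {z::complex. z ^ m = 1} \<ge> 2" by (simp add: card_roots_unity_eq)
  then have "\<not> {z::complex. z ^ m = 1} \<subseteq> {1}"
    using card_mono[of "{1::complex}" "{z. z ^ m = 1}"] by auto
  then obtain \<zeta> :: complex where \<zeta>: "\<zeta> ^ m = 1" "\<zeta> \<noteq> 1" by blast
  have "norm \<zeta> ^ m = 1 ^ m" using \<zeta>(1) by (simp flip: norm_power)
  then have n\<zeta>: "norm \<zeta> = 1"
    by (rule power_eq_imp_eq_base) (use C(1) in auto)
  have "openin (top_of_set (ball 0 1)) (ball 0 1 \<inter> \<alpha> -` U)"
    using C(2,4) assms(2) by (rule continuous_openin_preimage)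
  then have "open (ball 0 1 \<inter> \<alpha> -` U)" by (simp add: openin_open_eq)
  moreover have "0 \<in> ball 0 1 \<inter> \<alpha> -` U" using C(5) assms(3) by simp
  ultimately obtain e where e: "e > 0" "ball 0 e \<subseteq> ball 0 1 \<inter> \<alpha> -` U" by (meson openE)
  define w :: complex where "w = of_real (e / 2)"
  have w: "w \<in> ball 0 e" "\<zeta> * w \<in> ball 0 e" "w \<noteq> 0" using e(1) n\<zeta> by (auto simp: w_def norm_mult)
  have "f (\<alpha> w) = f (\<alpha> (\<zeta> * w))"
    using C(9)[of w] C(9)[of "\<zeta> * w"] w e(2) \<zeta>(1) by (auto simp: power_mult_distrib subset_iff)
  then have "\<alpha> w = \<alpha> (\<zeta> * w)"
    by (rule inj_onD[OF assms(4)]) (use w e in auto)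
  then have "w = \<zeta> * w"
    by (rule inj_onD[OF C(3)]) (use w e in auto)
  then show False using w(3) \<zeta>(2) by simp
qed

lemma power_locally_injective:
  fixes z0 :: complex
  assumes "z0 \<noteq> 0" "m \<ge> 1"
  obtains e where "e > 0" "inj_on (\<lambda>z. z ^ m) (ball z0 e)"
proof -
  have "finite {z::complex. z ^ m = 1}" using assms(2) by (intro finite_roots_unity) auto
  then obtain d where d: "d > 0" "\<And>\<zeta>::complex. \<zeta> ^ m = 1 \<Longrightarrow> \<zeta> \<noteq> 1 \<Longrightarrow> d \<le> dist 1 \<zeta>"
    using finite_set_avoid[of "{z::complex. z ^ m = 1}" 1] by auto
  \<comment> \<open>if two distinct points near \<open>z0\<close> have equal powers, their quotient is a nontrivial root of unity and their distance at least \<open>d * norm z\<close>\<close>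
  define e where "e = min (norm z0 / 2) (d * norm z0 / 4)"
  have e: "e > 0" "e \<le> norm z0 / 2" "e \<le> d * norm z0 / 4" using d assms by (auto simp: e_def)
  show ?thesis
  proof (rule that[OF e(1)], rule inj_onI, rule ccontr)
    fix z w assume zw: "z \<in> ball z0 e" "w \<in> ball z0 e" "z ^ m = w ^ m" "z \<noteq> w"
    have nz: "norm z > norm z0 / 2"
      using zw(1) e(2) norm_triangle_ineq2[of z0 z] by (simp add: dist_norm)
    then have "z \<noteq> 0" using assms(1) by auto
    define \<zeta> where "\<zeta> = w / z"
    have "\<zeta> ^ m = 1" 
      unfolding \<zeta>_def power_divide zw(3)[symmetric] using \<open>z \<noteq> 0\<close> by simp
    moreover have "w = \<zeta> * z" using \<open>z \<noteq> 0\<close> by (simp add: \<zeta>_def)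
    moreover from this have "\<zeta> \<noteq> 1" using zw(4) by auto
    ultimately have "d \<le> norm (1 - \<zeta>)" using d(2) by (simp add: dist_norm)
    have "norm (z - w) = norm (1 - \<zeta>) * norm z"
      unfolding \<open>w = \<zeta> * z\<close> by (simp add: algebra_simps flip: norm_mult)
    also have "\<dots> \<ge> d * (norm z0 / 2)"
      using \<open>d \<le> norm (1 - \<zeta>)\<close> nz d(1) by (intro mult_mono) auto
    finally have "norm (z - w) \<ge> 2 * e" using e(3) by simp
    moreover have "norm (z - w) < 2 * e"
      using zw(1,2) dist_triangle_half_r[of z0 z "2 * e" w] by (simp add: dist_norm)
    ultimately show False by simp
  qed
qed

definition fibre :: "('a::real_normed_vector \<Rightarrow> 'b) \<Rightarrow> 'b \<Rightarrow> 'a set" where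
  "fibre f x = {y \<in> sphere 0 1. f y = x}"

text \<open>
  Branched covers between spheres, except that nothing beyond continuity is demanded over a finite
  set \<open>B\<close> of points of the target. When a root is taken, the two points at which it is branched
  join \<open>B\<close>: they are of no further interest, and a local model there would require that
  homeomorphisms of the plane have winding number \<open>1\<close> or \<open>-1\<close>.

  The local degrees are a parameter, because the same function serves for a map and for all the roots
  that are taken from it.
\<close>

locale ramified_sphere_map =
  fixes f :: "'a::euclidean_space \<Rightarrow> 'b::euclidean_space" and deg :: "'a \<Rightarrow> nat" and B :: "'b set"
  assumes dim_domain: "DIM('a) = 3" and dim_target: "DIM('b) = 3"
    and continuous: "continuous_on (sphere 0 1) f"
    and into: "f \<in> sphere 0 1 \<rightarrow> sphere 0 1"
    and finite_exceptional: "finite B"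
    and model: "\<And>y. y \<in> sphere 0 1 \<Longrightarrow> f y \<notin> B \<Longrightarrow>
                  power_model (sphere 0 1) (sphere 0 1) f y (deg y)"
begin

text \<open>
  Each fibre is compact, and discrete because \<open>0\<close> is the only root of \<open>0\<close>.
\<close>

lemma finite_fibre:
  assumes "x \<notin> B"
  shows "finite (fibre f x)"
proof -
  have "compact (sphere 0 1 \<inter> (sphere 0 1 \<inter> f -` {x}))"
    by (intro compact_Int_closed compact_sphere continuous_closed_preimage continuous) auto
  moreover have "sphere 0 1 \<inter> (sphere 0 1 \<inter> f -` {x}) = fibre f x" by (auto simp: fibre_def)
  ultimately have "compact (fibre f x)" by (simp only:)
  moreover have "discrete (fibre f x)"
  proof (rule discreteI)
    fix y assume y: "y \<in> fibre f x"
    then have "f y = x" "y \<in> sphere 0 1" by (auto simp: fibre_def)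
    then obtain \<alpha> \<kappa> where c: "power_chart (sphere 0 1) (sphere 0 1) f y (deg y) \<alpha> \<kappa>"
      using model[of y] assms unfolding power_model_def by auto
    note C = power_chartD[OF c]
    have "openin (top_of_set (sphere 0 1)) (\<alpha> ` ball 0 1)"
      using C by (intro open_embedding_in_sphere_open_map dim_domain) auto
    then obtain T where T: "open T" "\<alpha> ` ball 0 1 = sphere 0 1 \<inter> T" by (auto simp: openin_open)
    have "T \<inter> fibre f x = {y}"
    proof
      show "{y} \<subseteq> T \<inter> fibre f x" using y C(5) T(2) by force
      show "T \<inter> fibre f x \<subseteq> {y}"
      proof
        fix u assume "u \<in> T \<inter> fibre f x"
        then have "u \<in> \<alpha> ` ball 0 1" "f u = x" using T(2) by (auto simp: fibre_def)
        then obtain z where z: "z \<in> ball 0 1" "u = \<alpha> z" "f (\<alpha> z) = x" by auto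
        then have "\<kappa> (z ^ deg y) = \<kappa> 0" using C(9) power_chart_centre[OF c] \<open>f y = x\<close> by simp
        moreover have "z ^ deg y \<in> ball 0 1" using norm_power_less_one C(1) z(1) by simp
        ultimately have "z ^ deg y = 0" using inj_onD[OF C(7)] by force
        then show "u \<in> {y}" using z C(5) by simp
      qed
    qed
    then show "y isolated_in fibre f x" using isolated_inI y T(1) by blast
  qed
  ultimately show ?thesis using discrete_compact_finite_iff by blast
qed

lemma deg_one_nearby:
  assumes c: "power_chart (sphere 0 1) (sphere 0 1) f y m \<alpha> \<kappa>"
    and z: "z \<in> ball 0 1" "z \<noteq> 0" and "f (\<alpha> z) \<notin> B"
  shows "deg (\<alpha> z) = 1"
proof -
  note C = power_chartD[OF c]
  obtain e where e: "e > 0" "inj_on (\<lambda>z. z ^ m) (ball z e)"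
    using power_locally_injective[OF z(2) C(1)] by blast
  define V where "V = ball z e \<inter> ball 0 1"
  show ?thesis
  proof (rule power_model_one_if_locally_injective)
    show "power_model (sphere 0 1) (sphere 0 1) f (\<alpha> z) (deg (\<alpha> z))"
      using C(4) z(1) assms(4) by (intro model) auto
    show "openin (top_of_set (sphere 0 1)) (\<alpha> ` V)"
      using C by (intro open_embedding_in_sphere_open_map dim_domain)
        (auto simp: V_def intro: continuous_on_subset inj_on_subset)
    show "\<alpha> z \<in> \<alpha> ` V" using z(1) e(1) by (auto simp: V_def)
    show "inj_on f (\<alpha> ` V)"
    proof (rule inj_onI)
      fix u u' assume "u \<in> \<alpha> ` V" "u' \<in> \<alpha> ` V" "f u = f u'"
      then obtain w w' where w: "w \<in> V" "w' \<in> V" "u = \<alpha> w" "u' = \<alpha> w'" "f (\<alpha> w) = f (\<alpha> w')"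
        by auto
      then have b: "w \<in> ball 0 1" "w' \<in> ball 0 1" by (auto simp: V_def)
      then have "\<kappa> (w ^ m) = \<kappa> (w' ^ m)" using C(9) w(5) by simp
      then have "w ^ m = w' ^ m"
        by (rule inj_onD[OF C(7)]) (use b norm_power_less_one C(1) in auto)
      then have "w = w'"
        by (rule inj_onD[OF e(2)]) (use w in \<open>auto simp: V_def\<close>)
      then show "u = u'" using w by simp
    qed
  qed
qed

text \<open>
  A nonzero \<open>v\<close> has as many roots as the exponent says and the local degree is one at each of
  them; \<open>0\<close> has the single root \<open>0\<close>, at which the local degree is the exponent.
\<close>

lemma local_fibre_sum:
  assumes c: "power_chart (sphere 0 1) (sphere 0 1) f y (deg y) \<alpha> \<kappa>"
    and \<epsilon>: "0 < \<epsilon>" "\<epsilon> \<le> 1" and x: "x \<in> \<kappa> ` ball 0 (\<epsilon> ^ deg y)" "x \<notin> B"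
  shows "sum deg (fibre f x \<inter> \<alpha> ` ball 0 \<epsilon>) = deg y"
proof -
  note C = power_chartD[OF c]
  obtain v where v: "norm v < \<epsilon> ^ deg y" "x = \<kappa> v" using x(1) by auto
  have v1: "v \<in> ball 0 1" using v(1) \<epsilon> power_le_one[of \<epsilon> "deg y"] by simp
  have eq: "fibre f x \<inter> \<alpha> ` ball 0 \<epsilon> = \<alpha> ` {z. z ^ deg y = v}"
  proof (intro set_eqI iffI)
    fix u assume "u \<in> fibre f x \<inter> \<alpha> ` ball 0 \<epsilon>"
    then obtain z where z: "norm z < \<epsilon>" "u = \<alpha> z" "f (\<alpha> z) = \<kappa> v"
      using v(2) by (auto simp: fibre_def)
    then have z1: "z \<in> ball 0 1" using \<epsilon> by simp
    then have "\<kappa> (z ^ deg y) = \<kappa> v" using C(9) z(3) by simp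
    then have "z ^ deg y = v"
      by (rule inj_onD[OF C(7)]) (use z1 v1 norm_power_less_one C(1) in auto)
    then show "u \<in> \<alpha> ` {z. z ^ deg y = v}" using z(2) by blast
  next
    fix u assume "u \<in> \<alpha> ` {z. z ^ deg y = v}"
    then obtain z where z: "z ^ deg y = v" "u = \<alpha> z" by blast
    then have "norm z ^ deg y < \<epsilon> ^ deg y" using v(1) by (simp flip: norm_power)
    then have "norm z < \<epsilon>" using \<epsilon> by (intro power_less_imp_less_base[of "norm z" "deg y"]) auto
    then have "z \<in> ball 0 \<epsilon>" "z \<in> ball 0 1" using \<epsilon> by auto
    moreover have "f (\<alpha> z) = x" using C(9) \<open>z \<in> ball 0 1\<close> z v(2) by simp
    moreover have "\<alpha> z \<in> sphere 0 1" using C(4) \<open>z \<in> ball 0 1\<close> by blast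
    ultimately show "u \<in> fibre f x \<inter> \<alpha> ` ball 0 \<epsilon>" using z(2) by (auto simp: fibre_def)
  qed
  show ?thesis
  proof (cases "v = 0")
    case True
    then have "{z::complex. z ^ deg y = v} = {0}" using C(1) by auto
    then show ?thesis unfolding eq using C(5) by simp
  next
    case False
    have roots: "z \<in> ball 0 1" "z \<noteq> 0" if "z ^ deg y = v" for z
    proof -
      have "norm z ^ deg y < 1" using v1 that by (simp flip: norm_power)
      then show "z \<in> ball 0 1" using C(1) by (simp add: power_less_one_iff)
      show "z \<noteq> 0" using that False C(1) by (auto simp: power_0_left)
    qed
    have deg1: "deg u = 1" if u: "u \<in> \<alpha> ` {z. z ^ deg y = v}" for u
    proof -
      obtain z where z: "z ^ deg y = v" "u = \<alpha> z" using u by blast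
      have "f (\<alpha> z) = x" unfolding v(2) C(9)[OF roots(1)[OF z(1)]] z(1) ..
      then show ?thesis using deg_one_nearby[OF c roots[OF z(1)]] x(2) unfolding z(2) by blast
    qed
    have "sum deg (\<alpha> ` {z. z ^ deg y = v}) = (\<Sum>u\<in>\<alpha> ` {z. z ^ deg y = v}. 1)"
      by (rule sum.cong[OF refl deg1])
    also have "\<dots> = card (\<alpha> ` {z. z ^ deg y = v})" by simp
    also have "\<dots> = card {z. z ^ deg y = v}"
      by (rule card_image, rule inj_on_subset[OF C(3)]) (use roots in blast)
    also have "\<dots> = deg y" using False C(1) by (intro card_nth_roots) auto
    finally show ?thesis unfolding eq .
  qed
qed

text \<open>
  Choose disjoint discs \<open>W y\<close> around the points \<open>y\<close> of the fibre. By compactness of the sphere,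
  the fibres over all points close to \<open>x0\<close> lie in the union of these discs, each of which
  contributes the local degree at its centre.
\<close>

lemma fibre_sum_locally_constant:
  assumes x0: "x0 \<in> sphere 0 1 - B"
  shows "\<exists>N. openin (top_of_set (sphere 0 1 - B)) N \<and> x0 \<in> N \<and>
    (\<forall>x\<in>N. sum deg (fibre f x0) = sum deg (fibre f x))"
proof -
  let ?Y = "sphere (0::'a) 1" and ?X = "sphere (0::'b) 1"
  define \<Phi> where "\<Phi> = fibre f x0"
  have fin: "finite \<Phi>" using finite_fibre x0 by (simp add: \<Phi>_def)
  have \<Phi>: "y \<in> ?Y" "f y = x0" if "y \<in> \<Phi>" for y using that by (auto simp: \<Phi>_def fibre_def)
  have "\<forall>y\<in>\<Phi>. \<exists>\<alpha>. \<exists>\<kappa>. power_chart ?Y ?X f y (deg y) \<alpha> \<kappa>"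
    using model \<Phi> x0 unfolding power_model_def by auto
  then obtain \<alpha> where "\<forall>y\<in>\<Phi>. \<exists>\<kappa>. power_chart ?Y ?X f y (deg y) (\<alpha> y) \<kappa>"
    by (rule bchoice[THEN exE])
  then obtain \<kappa> where ch: "\<forall>y\<in>\<Phi>. power_chart ?Y ?X f y (deg y) (\<alpha> y) (\<kappa> y)"
    by (rule bchoice[THEN exE])
  have C: "power_chart ?Y ?X f y (deg y) (\<alpha> y) (\<kappa> y)" if "y \<in> \<Phi>" for y using ch that by blast
  obtain \<delta> where \<delta>: "\<delta> > 0" "\<And>y y'. y \<in> \<Phi> \<Longrightarrow> y' \<in> \<Phi> \<Longrightarrow> dist y y' < \<delta> \<Longrightarrow> y = y'"
    using uniform_discrete_finite_iff[of \<Phi>] fin unfolding uniform_discrete_def by blast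
  have "\<exists>\<epsilon>>0. \<epsilon> \<le> 1 \<and> \<alpha> y ` ball 0 \<epsilon> \<subseteq> ball y (\<delta> / 2)" if y: "y \<in> \<Phi>" for y
  proof -
    have "isCont (\<alpha> y) 0"
      using power_chartD(2)[OF C[OF y]] by (simp add: continuous_on_eq_continuous_at)
    then obtain \<epsilon> where \<epsilon>: "\<epsilon> > 0" "\<And>z. dist z 0 < \<epsilon> \<Longrightarrow> dist (\<alpha> y z) (\<alpha> y 0) < \<delta> / 2"
      using \<delta>(1) unfolding continuous_at_eps_delta by (meson half_gt_zero)
    show ?thesis
    proof (intro exI[of _ "min \<epsilon> 1"] conjI)
      show "\<alpha> y ` ball 0 (min \<epsilon> 1) \<subseteq> ball y (\<delta> / 2)"
      proof
        fix u assume "u \<in> \<alpha> y ` ball 0 (min \<epsilon> 1)"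
        then obtain z where "u = \<alpha> y z" "dist z 0 < \<epsilon>" by (auto simp: dist_commute)
        then show "u \<in> ball y (\<delta> / 2)"
          using \<epsilon>(2) power_chartD(5)[OF C[OF y]] by (simp add: dist_commute)
      qed
    qed (use \<epsilon> in auto)
  qed
  then have "\<forall>y\<in>\<Phi>. \<exists>\<epsilon>. \<epsilon> > 0 \<and> \<epsilon> \<le> 1 \<and> \<alpha> y ` ball 0 \<epsilon> \<subseteq> ball y (\<delta> / 2)" by blast
  then obtain \<epsilon> where \<epsilon>: "\<forall>y\<in>\<Phi>. \<epsilon> y > 0 \<and> \<epsilon> y \<le> 1 \<and> \<alpha> y ` ball 0 (\<epsilon> y) \<subseteq> ball y (\<delta> / 2)"
    by (rule bchoice[THEN exE])
  define W where "W y = \<alpha> y ` ball 0 (\<epsilon> y)" for y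
  define V where "V y = \<kappa> y ` ball 0 (\<epsilon> y ^ deg y)" for y
  have openW: "openin (top_of_set ?Y) (W y)" if y: "y \<in> \<Phi>" for y
  proof -
    have "ball 0 (\<epsilon> y) \<subseteq> (ball 0 1 :: complex set)" using \<epsilon> y by auto
    then show ?thesis unfolding W_def using power_chartD[OF C[OF y]]
      by (intro open_embedding_in_sphere_open_map dim_domain)
        (auto intro: continuous_on_subset inj_on_subset)
  qed
  have openV: "openin (top_of_set ?X) (V y)" if y: "y \<in> \<Phi>" for y
  proof -
    have "ball 0 (\<epsilon> y ^ deg y) \<subseteq> (ball 0 1 :: complex set)"
      using \<epsilon> y power_le_one[of "\<epsilon> y" "deg y"] by (intro subset_ball) auto
    then show ?thesis unfolding V_def using power_chartD[OF C[OF y]]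
      by (intro open_embedding_in_sphere_open_map dim_target)
        (auto intro: continuous_on_subset inj_on_subset)
  qed
  have yW: "y \<in> W y" "x0 \<in> V y" if y: "y \<in> \<Phi>" for y
  proof -
    have "\<alpha> y 0 = y" "\<kappa> y 0 = x0" "\<epsilon> y > 0"
      using power_chartD(5)[OF C[OF y]] power_chart_centre[OF C[OF y]] \<Phi>[OF y] \<epsilon> y by auto
    then show "y \<in> W y" "x0 \<in> V y" unfolding W_def V_def by (force intro: image_eqI[of _ _ 0])+
  qed
  define Z where "Z = f ` (?Y - (\<Union>y\<in>\<Phi>. W y))"
  have "compact Z"
  proof -
    have "openin (top_of_set ?Y) (\<Union>y\<in>\<Phi>. W y)" using openW by blast
    then have "closedin (top_of_set ?Y) (?Y - (\<Union>y\<in>\<Phi>. W y))" by (auto intro: closedin_diff)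
    then have "compact (?Y - (\<Union>y\<in>\<Phi>. W y))" using closedin_compact compact_sphere by blast
    then show ?thesis unfolding Z_def
      by (intro compact_continuous_image continuous_on_subset[OF continuous]) auto
  qed
  define N where "N = ((\<Inter>y\<in>\<Phi>. V y) \<inter> ?X) - (B \<union> Z)"
  show ?thesis
  proof (intro exI[of _ N] conjI ballI)
    have "openin (top_of_set ?X) ((\<Inter>y\<in>\<Phi>. V y) \<inter> topspace (top_of_set ?X))"
      using fin openV by (intro openin_INT)
    then obtain T where T: "open T" "(\<Inter>y\<in>\<Phi>. V y) \<inter> ?X = ?X \<inter> T"
      by (auto simp: openin_open)
    have "closed (B \<union> Z)" using \<open>compact Z\<close> finite_exceptional
      by (intro closed_Un) (auto simp: finite_imp_closed compact_imp_closed)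
    then have "open (T - Z)" using T(1) \<open>compact Z\<close> by (intro open_Diff compact_imp_closed)
    moreover have "N = (?X - B) \<inter> (T - Z)" using T(2) unfolding N_def by blast
    ultimately show "openin (top_of_set (?X - B)) N" by blast
    have "x0 \<notin> Z"
    proof
      assume "x0 \<in> Z"
      then obtain y where "y \<in> ?Y" "f y = x0" "y \<notin> (\<Union>y\<in>\<Phi>. W y)" unfolding Z_def by blast
      moreover from this have "y \<in> \<Phi>" by (simp add: \<Phi>_def fibre_def)
      ultimately show False using yW(1) by blast
    qed
    then show "x0 \<in> N" using x0 yW(2) unfolding N_def by blast
    fix x assume x: "x \<in> N"
    then have xB: "x \<notin> B" and xZ: "x \<notin> Z" and xV: "\<And>y. y \<in> \<Phi> \<Longrightarrow> x \<in> V y"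
      unfolding N_def by auto
    have cover: "fibre f x = (\<Union>y\<in>\<Phi>. fibre f x \<inter> W y)"
      using xZ unfolding Z_def fibre_def by blast
    have "sum deg (\<Union>y\<in>\<Phi>. fibre f x \<inter> W y) = (\<Sum>y\<in>\<Phi>. sum deg (fibre f x \<inter> W y))"
    proof (rule sum.UNION_disjoint[OF fin])
      show "\<forall>y\<in>\<Phi>. finite (fibre f x \<inter> W y)" using finite_fibre[OF xB] by blast
      show "\<forall>y\<in>\<Phi>. \<forall>y'\<in>\<Phi>. y \<noteq> y' \<longrightarrow> (fibre f x \<inter> W y) \<inter> (fibre f x \<inter> W y') = {}"
      proof (intro ballI impI, rule ccontr)
        fix y y' assume y: "y \<in> \<Phi>" "y' \<in> \<Phi>" "y \<noteq> y'"
          and "(fibre f x \<inter> W y) \<inter> (fibre f x \<inter> W y') \<noteq> {}"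
        then obtain u where "u \<in> W y" "u \<in> W y'" by blast
        then have "dist y u < \<delta> / 2" "dist y' u < \<delta> / 2"
          using \<epsilon> y unfolding W_def by (auto simp: subset_iff)
        then have "dist y y' < \<delta>" using dist_triangle_half_r[of u y \<delta> y'] by (simp add: dist_commute)
        then show False using \<delta>(2) y by blast
      qed
    qed
    also have "\<dots> = (\<Sum>y\<in>\<Phi>. deg y)"
    proof (rule sum.cong)
      fix y assume y: "y \<in> \<Phi>"
      show "sum deg (fibre f x \<inter> W y) = deg y"
        using local_fibre_sum[OF C[OF y], of "\<epsilon> y" x] \<epsilon> y xV[OF y] xB by (auto simp: W_def V_def)
    qed simp
    finally show "sum deg (fibre f x0) = sum deg (fibre f x)" using cover by (simp add: \<Phi>_def)
  qed
qed

lemma fibre_sum_constant: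
  assumes "x \<in> sphere 0 1 - B" "x' \<in> sphere 0 1 - B"
  shows "sum deg (fibre f x) = sum deg (fibre f x')"
proof (rule connected_equivalence_relation[of "sphere 0 1 - B"])
  show "connected (sphere 0 1 - B)"
    by (intro connected_sphere_minus_finite dim_target finite_exceptional)
qed (use assms fibre_sum_locally_constant in auto)

end

section \<open>Lifting through a power map of the sphere\<close>

text \<open>
  Stereographic projection from one of the punctures reduces this to the plane: that
  puncture goes to infinity, and the local roots at the others are carried over.
\<close>

lemma sphere_root:
  fixes F :: "'a::euclidean_space \<Rightarrow> complex"
  assumes dim: "DIM('a) = 3" and P: "finite P" "P \<subseteq> sphere 0 1" "P \<noteq> {}" and s: "s \<ge> 1"
    and cont: "continuous_on (sphere 0 1 - P) F" and nz: "\<And>y. y \<in> sphere 0 1 - P \<Longrightarrow> F y \<noteq> 0"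
    and loc: "\<And>p. p \<in> P \<Longrightarrow> \<exists>U H. openin (top_of_set (sphere 0 1)) U \<and> p \<in> U \<and>
           continuous_on (U - {p}) H \<and> (\<forall>y\<in>U - {p}. F y = H y ^ s)"
  obtains H where "continuous_on (sphere 0 1 - P) H" "\<And>y. y \<in> sphere 0 1 - P \<Longrightarrow> H y ^ s = F y"
proof -
  let ?Y = "sphere (0::'a) 1"
  obtain q where q: "q \<in> P" using P(3) by blast
  obtain \<theta> \<theta>' where \<theta>: "homeomorphism (?Y - {q}) (UNIV :: complex set) \<theta> \<theta>'"
    using punctured_sphere_homeomorphic_plane[OF dim, of q] q P(2) unfolding homeomorphic_def by blast
  have \<theta>': "\<theta>' z \<in> ?Y" "\<theta>' z \<noteq> q" "\<theta> (\<theta>' z) = z" for z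
    using homeomorphism_image2[OF \<theta>] homeomorphism_apply2[OF \<theta>] by blast+
  have inv: "\<theta>' (\<theta> y) = y" if "y \<in> ?Y" "y \<noteq> q" for y
    using homeomorphism_apply1[OF \<theta>] that by blast
  define K where "K = \<theta> ` (P - {q})"
  have K: "\<theta>' z \<in> ?Y - P" if "z \<in> - K" for z
  proof -
    have "\<theta>' z \<notin> P"
    proof
      assume "\<theta>' z \<in> P"
      then have "\<theta> (\<theta>' z) \<in> K" unfolding K_def using \<theta>'(2) by blast
      then show False using that \<theta>'(3) by simp
    qed
    then show ?thesis using \<theta>'(1) by blast
  qed
  have cont\<theta>': "continuous_on T \<theta>'" for T
    using homeomorphism_cont2[OF \<theta>] by (rule continuous_on_subset) simp
  have "\<exists>G. continuous_on (- K) G \<and> (\<forall>z\<in>- K. G z ^ s = F (\<theta>' z))"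
  proof (rule planar_root[OF _ s])
    show "finite K" using P(1) by (simp add: K_def)
    show "continuous_on (- K) (\<lambda>z. F (\<theta>' z))"
      by (rule continuous_on_compose2[OF cont cont\<theta>']) (use K in blast)
    show "F (\<theta>' z) \<noteq> 0" if "z \<notin> K" for z using nz[OF K] that by simp
    fix k assume "k \<in> K"
    then obtain p where p: "p \<in> P" "p \<noteq> q" "k = \<theta> p" by (auto simp: K_def)
    obtain U H where U: "openin (top_of_set ?Y) U" "p \<in> U" and contH: "continuous_on (U - {p}) H"
      and H: "\<And>y. y \<in> U - {p} \<Longrightarrow> F y = H y ^ s" using loc[OF p(1)] by blast
    have "openin (top_of_set (?Y - {q})) ((?Y - {q}) \<inter> U)"
      using U(1) by (auto simp: openin_open)
    then have "open (\<theta> ` ((?Y - {q}) \<inter> U))" using homeomorphism_imp_open_map[OF \<theta>] by simp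
    moreover have "k \<in> \<theta> ` ((?Y - {q}) \<inter> U)" using p U(2) P(2) by blast
    ultimately obtain R where R: "R > 0" "ball k R \<subseteq> \<theta> ` ((?Y - {q}) \<inter> U)" by (meson openE)
    have in_U: "\<theta>' z \<in> U - {p}" if z: "z \<in> ball k R - {k}" for z
    proof -
      obtain y where y: "y \<in> ?Y" "y \<noteq> q" "y \<in> U" "z = \<theta> y" using R(2) z by blast
      then have "\<theta>' z = y" using inv by simp
      moreover have "y \<noteq> p" using z y(4) p(3) by auto
      ultimately show ?thesis using y(3) by simp
    qed
    show "\<exists>R>0. \<exists>H. continuous_on (ball k R - {k}) H \<and> (\<forall>z\<in>ball k R - {k}. F (\<theta>' z) = H z ^ s)"
    proof (intro exI[of _ R] conjI exI[of _ "\<lambda>z. H (\<theta>' z)"] ballI)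
      show "continuous_on (ball k R - {k}) (\<lambda>z. H (\<theta>' z))"
        by (rule continuous_on_compose2[OF contH cont\<theta>']) (use in_U in blast)
      show "F (\<theta>' z) = H (\<theta>' z) ^ s" if "z \<in> ball k R - {k}" for z using H[OF in_U[OF that]] .
    qed (rule R(1))
  qed
  then obtain G where G: "continuous_on (- K) G" "\<And>z. z \<in> - K \<Longrightarrow> G z ^ s = F (\<theta>' z)" by blast
  have offK: "\<theta> y \<in> - K" if y: "y \<in> ?Y - P" for y
  proof
    assume "\<theta> y \<in> K"
    then obtain p where p: "p \<in> P" "p \<noteq> q" "\<theta> y = \<theta> p" unfolding K_def by blast
    then have "y = p" using inv[of y] inv[of p] y q P(2) by (metis DiffD1 DiffD2 subsetD)
    then show False using p(1) y by simp
  qed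
  show ?thesis
  proof (rule that[of "\<lambda>y. G (\<theta> y)"])
    show "continuous_on (?Y - P) (\<lambda>y. G (\<theta> y))"
    proof (rule continuous_on_compose2[OF G(1)])
      show "continuous_on (?Y - P) \<theta>"
        using homeomorphism_cont1[OF \<theta>] by (rule continuous_on_subset) (use q in blast)
    qed (use offK in blast)
    show "G (\<theta> y) ^ s = F y" if y: "y \<in> ?Y - P" for y
    proof -
      have "\<theta>' (\<theta> y) = y" using inv y q by blast
      then show ?thesis using G(2)[OF offK[OF y]] by simp
    qed
  qed
qed

text \<open>
  The suspension of the power map of the circle: on the unit sphere it keeps the height
  \<open>snd p\<close> and raises the direction of \<open>fst p\<close> to the power \<open>s\<close>. As \<open>sgn 0 = 0\<close>, it fixes the poles.
\<close>

definition sphere_power :: "nat \<Rightarrow> complex \<times> real \<Rightarrow> complex \<times> real" where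
  "sphere_power s p = (sgn (fst p) ^ s * of_real (norm (fst p)), snd p)"

text \<open>
  The point \<open>p\<close> rotated about the axis into the direction of \<open>b\<close>. When \<open>b\<close> is a root of \<open>fst p\<close> of
  order \<open>s\<close>, this is a preimage of \<open>p\<close> under \<open>sphere_power s\<close>.
\<close>

definition with_argument :: "complex \<Rightarrow> complex \<times> real \<Rightarrow> complex \<times> real" where
  "with_argument b p = (sgn b * of_real (norm (fst p)), snd p)"

lemma sgn_power_complex: "sgn (b ^ s) = sgn (b::complex) ^ s"
  by (induction s) (simp_all add: sgn_mult)

lemma sgn_times_norm: "sgn w * of_real (norm w) = (w::complex)"
  by (cases "w = 0") (simp_all add: sgn_div_norm scaleR_conv_of_real)

lemma norm_fst_sphere_power:
  "norm (fst (sphere_power s p)) = norm (fst p)"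
  by (cases "fst p = 0") (simp_all add: sphere_power_def norm_mult norm_power norm_sgn)

lemma norm_sphere_power: "norm (sphere_power s p) = norm p"
  using norm_fst_sphere_power[of s p] by (simp add: norm_prod_def sphere_power_def)

lemma sphere_power_with_argument:
  assumes "s \<ge> 1" "fst p \<noteq> 0 \<Longrightarrow> b ^ s = fst p"
  shows "sphere_power s (with_argument b p) = p" "norm (with_argument b p) = norm p"
proof -
  have *: "norm (fst (with_argument b p)) = norm (fst p) \<and> sphere_power s (with_argument b p) = p"
  proof (cases "fst p = 0")
    case True
    then show ?thesis by (simp add: with_argument_def sphere_power_def prod_eq_iff)
  next
    case False
    then have b: "b ^ s = fst p" "b \<noteq> 0" using assms by (auto simp: power_0_left)
    then have "norm (sgn b) = 1" "sgn b ^ s = sgn (fst p)"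
      by (simp_all add: norm_sgn flip: sgn_power_complex)
    moreover have "sgn (fst p) * of_real (norm (fst p)) = fst p" by (rule sgn_times_norm)
    moreover have "sgn (sgn b * of_real (norm (fst p))) = sgn b"
      using False by (simp add: sgn_mult sgn_of_real)
    ultimately show ?thesis
      by (simp add: with_argument_def sphere_power_def prod_eq_iff norm_mult)
  qed
  then show "sphere_power s (with_argument b p) = p" by blast
  show "norm (with_argument b p) = norm p"
    using * by (simp add: norm_prod_def with_argument_def)
qed

lemma sphere_power_fibre_pole:
  assumes "fst p = 0"
  shows "sphere_power s -` {p} = {p}"
proof (intro set_eqI iffI)
  fix q assume "q \<in> sphere_power s -` {p}"
  then have "sphere_power s q = p" by simp
  then have "norm (fst q) = 0" "snd q = snd p"
    using norm_fst_sphere_power[of s q] assms by (auto simp: sphere_power_def)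
  then show "q \<in> {p}" using assms by (simp add: prod_eq_iff)
qed (use assms in \<open>simp add: sphere_power_def prod_eq_iff\<close>)

lemma sphere_power_fibre:
  assumes "s \<ge> 1" "fst p \<noteq> 0"
  shows "card (sphere_power s -` {p}) = s"
proof -
  let ?R = "{\<omega>. \<omega> ^ s = sgn (fst p)}" and ?e = "\<lambda>\<omega>. (\<omega> * of_real (norm (fst p)), snd p)"
  note p = sgn_times_norm[of "fst p"]
  have "sphere_power s -` {p} = ?e ` ?R"
  proof (intro set_eqI iffI)
    fix q assume "q \<in> sphere_power s -` {p}"
    then have q: "sphere_power s q = p" by simp
    then have n: "norm (fst q) = norm (fst p)" using norm_fst_sphere_power by metis
    then have "fst q \<noteq> 0" using assms(2) by auto
    have "sgn (fst q) ^ s * of_real (norm (fst p)) = sgn (fst p) * of_real (norm (fst p))"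
      using q n p by (auto simp: sphere_power_def prod_eq_iff)
    then have "sgn (fst q) ^ s = sgn (fst p)" using assms(2) by simp
    moreover have "q = ?e (sgn (fst q))"
      using q sgn_times_norm[of "fst q"] unfolding n by (auto simp: prod_eq_iff sphere_power_def)
    ultimately show "q \<in> ?e ` ?R" by blast
  next
    fix q assume "q \<in> ?e ` ?R"
    then obtain \<omega> where \<omega>: "\<omega> ^ s = sgn (fst p)" "q = ?e \<omega>" by blast
    have "norm \<omega> ^ s = 1 ^ s" using \<omega>(1) assms(2) by (simp add: norm_sgn flip: norm_power)
    then have n: "norm \<omega> = 1" by (rule power_eq_imp_eq_base) (use assms(1) in auto)
    then have "sgn \<omega> = \<omega>" by (simp add: sgn_div_norm)
    then show "q \<in> sphere_power s -` {p}"
      using \<omega> p n assms(2) by (simp add: sphere_power_def prod_eq_iff norm_mult sgn_mult sgn_of_real)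
  qed
  moreover have "inj_on ?e ?R" using assms(2) by (auto intro: inj_onI)
  moreover have "card ?R = s" using assms by (intro card_nth_roots) (auto simp: sgn_zero_iff)
  ultimately show ?thesis by (simp add: card_image)
qed

lemma finite_sphere_power_vimage:
  assumes "s \<ge> 1" "finite Q"
  shows "finite (sphere_power s -` Q)"
proof -
  have "finite (sphere_power s -` {p})" for p
  proof (cases "fst p = 0")
    case True
    then show ?thesis by (simp add: sphere_power_fibre_pole)
  next
    case False
    then show ?thesis using sphere_power_fibre[OF assms(1) False] assms(1) by (auto intro: card_ge_0_finite)
  qed
  moreover have "sphere_power s -` Q = (\<Union>p\<in>Q. sphere_power s -` {p})" by blast
  ultimately show ?thesis using assms(2) by simp
qed

lemma sphere_pole_iff:
  assumes "p \<in> sphere (0::complex \<times> real) 1"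
  shows "fst p = 0 \<longleftrightarrow> p \<in> {(0, 1), (0, -1)}"
proof -
  have "norm (fst p) ^ 2 + (snd p) ^ 2 = 1" using assms by (simp add: norm_prod_def)
  then show ?thesis by (auto simp: prod_eq_iff power2_eq_1_iff)
qed

text \<open>
  In a local model, \<open>fst (f y) = u (z ^ m)\<close> where \<open>u v = v^n * exp (L v)\<close> on a punctured disc.
  Substituting \<open>v = z ^ m\<close> with \<open>s dvd m\<close> makes both factors powers of exponent \<open>s\<close>, whatever the
  winding number \<open>n\<close> is.
\<close>

lemma local_root_at_pole:
  fixes f :: "'a::euclidean_space \<Rightarrow> complex \<times> real"
  assumes dim: "DIM('a) = 3" and c: "power_chart (sphere 0 1) (sphere 0 1) f p m \<alpha> \<kappa>"
    and pole: "fst (f p) = 0" and s: "s dvd m" "s \<ge> 1"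
  shows "\<exists>U H. openin (top_of_set (sphere 0 1)) U \<and> p \<in> U \<and>
           continuous_on (U - {p}) H \<and> (\<forall>y\<in>U - {p}. fst (f y) = H y ^ s)"
proof -
  note C = power_chartD[OF c]
  obtain m' where m': "m = s * m'" using s by blast
  define u where "u v = fst (\<kappa> v)" for v
  have "finite {v \<in> ball 0 1. u v = 0}"
  proof (rule finite_imageD)
    have "\<kappa> ` {v \<in> ball 0 1. u v = 0} \<subseteq> {(0, 1), (0, -1)}"
    proof (rule image_subsetI)
      fix v assume "v \<in> {v \<in> ball 0 1. u v = 0}"
      then have "\<kappa> v \<in> sphere 0 1" "fst (\<kappa> v) = 0" using C(8) by (auto simp only: u_def Pi_iff)
      then show "\<kappa> v \<in> {(0, 1), (0, -1)}" using sphere_pole_iff by blast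
    qed
    then show "finite (\<kappa> ` {v \<in> ball 0 1. u v = 0})" by (rule finite_subset) simp
    show "inj_on \<kappa> {v \<in> ball 0 1. u v = 0}" using C(7) by (rule inj_on_subset) blast
  qed
  then obtain d where d: "d > 0" "\<And>v. v \<in> ball 0 1 \<Longrightarrow> u v = 0 \<Longrightarrow> v \<noteq> 0 \<Longrightarrow> d \<le> norm v"
    using finite_set_avoid[of "{v \<in> ball 0 1. u v = 0}" 0] by (auto simp: dist_norm)
  \<comment> \<open>since \<open>\<kappa>\<close> is injective, \<open>u\<close> vanishes at most twice, and \<open>\<rho>\<close> avoids a zero other than \<open>0\<close>\<close>
  define \<rho> where "\<rho> = min d 1"
  have \<rho>: "\<rho> > 0" "\<rho> \<le> 1" using d by (auto simp: \<rho>_def)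
  have sub: "ball 0 \<rho> \<subseteq> (ball 0 1 :: complex set)" using \<rho> by auto
  have nz: "u v \<noteq> 0" if "v \<in> ball 0 \<rho> - {0}" for v
    using d(2)[of v] that by (auto simp: \<rho>_def)
  obtain n L where contL: "continuous_on (ball 0 \<rho> - {0}) L"
    and L: "\<And>v. v \<in> ball 0 \<rho> - {0} \<Longrightarrow> u v = v powi n * exp (L v)"
  proof (rule punctured_disc_logarithm[of 0 \<rho> u])
    show "continuous_on (ball 0 \<rho> - {0}) u"
      unfolding u_def by (intro continuous_intros continuous_on_subset[OF C(6)]) (use sub in blast)
  qed (use nz in auto)
  have pow: "z ^ m \<in> ball 0 \<rho> - {0}" if "z \<in> ball 0 \<rho> - {0}" for z :: complex
  proof -
    have "norm z ^ m \<le> norm z ^ 1" using that \<rho> C(1) by (intro power_decreasing) auto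
    then show ?thesis using that by (auto simp: norm_power)
  qed
  obtain \<beta> where \<beta>: "homeomorphism (ball 0 \<rho>) (\<alpha> ` ball 0 \<rho>) \<alpha> \<beta>"
  proof (rule embedding_in_sphere_homeomorphism[OF dim])
    show "continuous_on (ball 0 \<rho>) \<alpha>" using C(2) sub by (rule continuous_on_subset)
    show "inj_on \<alpha> (ball 0 \<rho>)" using C(3) sub by (rule inj_on_subset)
    show "\<alpha> \<in> ball 0 \<rho> \<rightarrow> sphere 0 1" using C(4) sub by blast
  qed auto
  define R where "R z = (z ^ m') powi n * exp (L (z ^ m) / of_nat s)" for z
  have contR: "continuous_on (ball 0 \<rho> - {0}) R"
    unfolding R_def using s
    by (intro continuous_intros continuous_on_compose2[OF contL]) (use pow in auto)
  have R: "R z ^ s = u (z ^ m)" if z: "z \<in> ball 0 \<rho> - {0}" for z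
  proof -
    have "exp (L (z ^ m) / of_nat s) ^ s = exp (L (z ^ m))"
      using s by (simp flip: exp_of_nat_mult)
    moreover have "((z ^ m') powi n) ^ s = (z ^ m) powi n"
      by (simp add: power_int_power power_int_power' m' mult_ac)
    ultimately show ?thesis using L[OF pow[OF z]] by (simp add: R_def power_mult_distrib)
  qed
  have \<beta>U: "\<beta> y \<in> ball 0 \<rho> - {0}" "\<alpha> (\<beta> y) = y" if y: "y \<in> \<alpha> ` ball 0 \<rho> - {p}" for y
  proof -
    obtain z where z: "z \<in> ball 0 \<rho>" "y = \<alpha> z" "y \<noteq> p" using y by blast
    then have "\<beta> y = z" using homeomorphism_apply1[OF \<beta>] by simp
    moreover have "z \<noteq> 0" using z C(5) by auto
    ultimately show "\<beta> y \<in> ball 0 \<rho> - {0}" "\<alpha> (\<beta> y) = y" using z by auto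
  qed
  show ?thesis
  proof (intro exI[of _ "\<alpha> ` ball 0 \<rho>"] exI[of _ "\<lambda>y. R (\<beta> y)"] conjI ballI)
    show "openin (top_of_set (sphere 0 1)) (\<alpha> ` ball 0 \<rho>)"
    proof (rule open_embedding_in_sphere_open_map[OF dim])
      show "continuous_on (ball 0 \<rho>) \<alpha>" using C(2) sub by (rule continuous_on_subset)
      show "inj_on \<alpha> (ball 0 \<rho>)" using C(3) sub by (rule inj_on_subset)
      show "\<alpha> \<in> ball 0 \<rho> \<rightarrow> sphere 0 1" using C(4) sub by blast
    qed auto
    show "p \<in> \<alpha> ` ball 0 \<rho>" using C(5) \<rho> by (intro image_eqI[of _ _ 0]) auto
    show "continuous_on (\<alpha> ` ball 0 \<rho> - {p}) (\<lambda>y. R (\<beta> y))"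
    proof (rule continuous_on_compose2[OF contR])
      show "continuous_on (\<alpha> ` ball 0 \<rho> - {p}) \<beta>"
        using homeomorphism_cont2[OF \<beta>] by (rule continuous_on_subset) blast
      show "\<beta> ` (\<alpha> ` ball 0 \<rho> - {p}) \<subseteq> ball 0 \<rho> - {0}"
        using \<beta>U(1) by (rule image_subsetI)
    qed
    fix y assume y: "y \<in> \<alpha> ` ball 0 \<rho> - {p}"
    have "\<beta> y \<in> ball 0 1" using \<beta>U(1)[OF y] sub by blast
    then have "f y = \<kappa> (\<beta> y ^ m)" using C(9)[of "\<beta> y"] \<beta>U(2)[OF y] by simp
    then show "fst (f y) = R (\<beta> y) ^ s" using R[OF \<beta>U(1)[OF y]] by (simp add: u_def)
  qed
qed

text \<open>
  A root \<open>H\<close> of the horizontal coordinate \<open>fst (f y)\<close> away from the preimages of the poles supplies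
  the arguments of the lift \<open>h\<close>. It extends continuously to these preimages because \<open>h\<close> has the same
  distance from the axis as \<open>f\<close>, which tends to zero there.
\<close>

lemma lift_through_sphere_power:
  fixes f :: "'a::euclidean_space \<Rightarrow> complex \<times> real"
  assumes ram: "ramified_sphere_map f deg B" and s: "s \<ge> 1"
    and poles: "{(0, 1), (0, -1)} \<inter> B = {}"
    and dvd: "\<And>y. y \<in> sphere 0 1 \<Longrightarrow> fst (f y) = 0 \<Longrightarrow> s dvd deg y"
    and ne: "\<exists>y\<in>sphere 0 1. fst (f y) = 0"
  obtains h where "ramified_sphere_map h deg (sphere_power s -` (B \<union> {(0, 1), (0, -1)}))"
    "\<And>y. y \<in> sphere 0 1 \<Longrightarrow> f y = sphere_power s (h y)"
proof -
  interpret ramified_sphere_map f deg B by (rule ram)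
  let ?Y = "sphere (0::'a) 1" and ?X = "sphere (0::complex \<times> real) 1"
  let ?N = "{(0, 1), (0, -1)} :: (complex \<times> real) set"
  define P where "P = {y \<in> ?Y. fst (f y) = 0}"
  have intoX: "f y \<in> ?X" if "y \<in> ?Y" for y using into that by blast
  have P_iff: "y \<in> P \<longleftrightarrow> y \<in> ?Y \<and> f y \<in> ?N" for y
    using sphere_pole_iff[OF intoX] by (auto simp: P_def)
  have "P = fibre f (0, 1) \<union> fibre f (0, -1)" using P_iff by (auto simp: fibre_def)
  then have finP: "finite P" using finite_fibre poles by auto
  obtain H where contH: "continuous_on (?Y - P) H" and H: "\<And>y. y \<in> ?Y - P \<Longrightarrow> H y ^ s = fst (f y)"
  proof (rule sphere_root[OF dim_domain finP _ _ s, of "\<lambda>y. fst (f y)"])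
    show "continuous_on (?Y - P) (\<lambda>y. fst (f y))"
      by (intro continuous_intros continuous_on_subset[OF continuous]) blast
    fix p assume p: "p \<in> P"
    then have "p \<in> ?Y" "f p \<notin> B" using P_iff poles by auto
    then obtain \<alpha> \<kappa> where "power_chart ?Y ?X f p (deg p) \<alpha> \<kappa>"
      using model unfolding power_model_def by blast
    then show "\<exists>U H. openin (top_of_set ?Y) U \<and> p \<in> U \<and>
        continuous_on (U - {p}) H \<and> (\<forall>y\<in>U - {p}. fst (f y) = H y ^ s)"
      using p dvd[of p] s by (intro local_root_at_pole[OF dim_domain]) (auto simp: P_def)
  qed (use ne in \<open>auto simp: P_def\<close>)
  define h where "h y = with_argument (H y) (f y)" for y
  have Heq: "H y ^ s = fst (f y)" if "y \<in> ?Y" "fst (f y) \<noteq> 0" for y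
    using H[of y] that by (auto simp: P_def)
  have h_pow: "sphere_power s (h y) = f y" and h_norm: "norm (h y) = norm (f y)" if "y \<in> ?Y" for y
    using sphere_power_with_argument[of s "f y" "H y"] Heq[OF that] s by (auto simp: h_def)
  have h_small: "norm (fst (h y)) = norm (fst (f y))" if "y \<in> ?Y" for y
    using norm_fst_sphere_power[of s "h y"] h_pow[OF that] by simp
  have cont_fst: "continuous_on ?Y (\<lambda>y. fst (h y))"
    unfolding continuous_on_eq_continuous_within
  proof
    fix y assume y: "y \<in> ?Y"
    show "continuous (at y within ?Y) (\<lambda>y. fst (h y))"
    proof (cases "y \<in> P")
      case True
      have "((\<lambda>u. norm (fst (f u))) \<longlongrightarrow> norm (fst (f y))) (at y within ?Y)"
        using continuous y by (intro tendsto_intros) (simp add: continuous_on)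
      then have "((\<lambda>u. norm (fst (f u))) \<longlongrightarrow> 0) (at y within ?Y)" using True by (simp add: P_def)
      then have "((\<lambda>u. fst (h u)) \<longlongrightarrow> 0) (at y within ?Y)"
        by (rule Lim_null_comparison[rotated]) (simp add: eventually_at_filter h_small)
      moreover have "fst (h y) = 0" using True h_small[OF y] by (simp add: P_def)
      ultimately show ?thesis by (simp add: continuous_within)
    next
      case False
      have "continuous_on (?Y - P) (\<lambda>y. fst (h y))"
        unfolding h_def with_argument_def fst_conv
      proof (intro continuous_intros contH continuous_on_subset[OF continuous] ballI)
        show "H u \<noteq> 0" if "u \<in> ?Y - P" for u
          using H[OF that] that s by (auto simp: P_def power_0_left)
      qed auto
      then have "continuous (at y within ?Y - P) (\<lambda>y. fst (h y))"
        using y False by (simp add: continuous_on_eq_continuous_within)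
      moreover have "at y within ?Y - P = at y within ?Y"
        using finP False by (intro at_within_nhd[of y "- P"]) (auto simp: finite_imp_closed open_Compl)
      ultimately show ?thesis by simp
    qed
  qed
  have "continuous_on ?Y h"
  proof -
    have "continuous_on ?Y (\<lambda>y. (fst (h y), snd (f y)))"
      by (intro continuous_intros cont_fst continuous)
    then show ?thesis by (simp add: h_def with_argument_def)
  qed
  moreover have "power_model ?Y ?X h y (deg y)"
    if y: "y \<in> ?Y" and hB: "h y \<notin> sphere_power s -` (B \<union> ?N)" for y
  proof -
    have fB: "f y \<notin> B" and fN: "fst (f y) \<noteq> 0"
      using hB h_pow[OF y] P_iff[of y] y by (auto simp: P_def)
    then obtain \<alpha> \<kappa> where c: "power_chart ?Y ?X f y (deg y) \<alpha> \<kappa>"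
      using model[OF y] unfolding power_model_def by blast
    note C = power_chartD[OF c]
    define u where "u v = fst (\<kappa> v)" for v
    have contu: "continuous_on (ball 0 1) u" unfolding u_def by (intro continuous_intros C(6))
    have "open (ball 0 1 \<inter> u -` (- {0}))"
      using contu by (intro continuous_open_preimage) auto
    moreover have "0 \<in> ball 0 1 \<inter> u -` (- {0})"
      using fN power_chart_centre[OF c] by (simp add: u_def)
    ultimately obtain \<rho> where \<rho>: "\<rho> > 0" "ball 0 \<rho> \<subseteq> ball 0 1 \<inter> u -` (- {0})" by (meson openE)
    have sub: "ball 0 \<rho> \<subseteq> (ball 0 1 :: complex set)" using \<rho>(2) by blast
    then have \<rho>1: "\<rho> \<le> 1" using \<rho>(1) by (simp add: ball_subset_ball_iff)
    have nz: "u v \<noteq> 0" if "v \<in> ball 0 \<rho>" for v using \<rho>(2) that by auto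
    obtain l where l: "continuous_on (ball 0 \<rho>) l" "\<And>v. v \<in> ball 0 \<rho> \<Longrightarrow> u v = exp (l v)"
      using continuous_logarithm_on_ball[OF continuous_on_subset[OF contu sub] nz] by blast
    \<comment> \<open>a root of the horizontal coordinate in the target disc, proportional to the global root \<open>H\<close>\<close>
    define K where "K v = exp (l v / of_nat s)" for v
    have contK: "continuous_on (ball 0 \<rho>) K"
      unfolding K_def using l(1) s by (intro continuous_intros) auto
    have K: "K v ^ s = u v" if "v \<in> ball 0 \<rho>" for v
      using l(2)[OF that] s by (simp add: K_def flip: exp_of_nat_mult)
    have pow: "z ^ deg y \<in> ball 0 \<rho>" if "z \<in> ball 0 \<rho>" for z :: complex
    proof -
      have "norm z ^ deg y \<le> norm z ^ 1" using that \<rho>1 C(1) by (intro power_decreasing) auto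
      then show ?thesis using that by (auto simp: norm_power)
    qed
    have f\<alpha>: "f (\<alpha> z) = \<kappa> (z ^ deg y)" "\<alpha> z \<in> ?Y - P" if z: "z \<in> ball 0 \<rho>" for z
    proof -
      show 1: "f (\<alpha> z) = \<kappa> (z ^ deg y)" using C(9) sub z by blast
      have "u (z ^ deg y) \<noteq> 0" using nz[OF pow[OF z]] .
      moreover have "\<alpha> z \<in> ?Y" using C(4) sub z by blast
      ultimately show "\<alpha> z \<in> ?Y - P" using 1 by (simp add: P_def u_def)
    qed
    obtain c where c: "c ^ s = 1" "\<And>z. z \<in> ball 0 \<rho> \<Longrightarrow> H (\<alpha> z) = c * K (z ^ deg y)"
    proof (rule continuous_roots_differ_by_constant[of "ball 0 \<rho>" "\<lambda>z. H (\<alpha> z)" "\<lambda>z. K (z ^ deg y)" s])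
      show "connected (ball (0::complex) \<rho>)" by (rule connected_ball)
      show "continuous_on (ball 0 \<rho>) (\<lambda>z. H (\<alpha> z))"
        by (rule continuous_on_compose2[OF contH continuous_on_subset[OF C(2) sub]]) (use f\<alpha> in blast)
      show "continuous_on (ball 0 \<rho>) (\<lambda>z. K (z ^ deg y))"
        by (rule continuous_on_compose2[OF contK]) (use pow in \<open>auto intro!: continuous_intros\<close>)
      show "H (\<alpha> z) ^ s = K (z ^ deg y) ^ s" if z: "z \<in> ball 0 \<rho>" for z
        using K[OF pow[OF z]] H[OF f\<alpha>(2)[OF z]] f\<alpha>(1)[OF z] by (simp add: u_def)
    qed (use s in \<open>auto simp: K_def\<close>)
    define \<kappa>' where "\<kappa>' v = with_argument (c * K v) (\<kappa> v)" for v
    have \<kappa>': "sphere_power s (\<kappa>' v) = \<kappa> v" "norm (\<kappa>' v) = norm (\<kappa> v)" if "v \<in> ball 0 \<rho>" for v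
      using sphere_power_with_argument[OF s, of "\<kappa> v" "c * K v"] K[OF that] c(1)
      by (simp_all add: \<kappa>'_def u_def power_mult_distrib)
    show ?thesis
    proof (rule power_modelI_small_disc[OF C(1) \<rho>(1) \<rho>1])
      show "continuous_on (ball 0 \<rho>) \<alpha>" using C(2) sub by (rule continuous_on_subset)
      show "inj_on \<alpha> (ball 0 \<rho>)" using C(3) sub by (rule inj_on_subset)
      show "\<alpha> \<in> ball 0 \<rho> \<rightarrow> ?Y" using C(4) sub by blast
      have "c \<noteq> 0" using c(1) s by (auto simp: power_0_left)
      then show "continuous_on (ball 0 \<rho>) \<kappa>'"
        unfolding \<kappa>'_def with_argument_def
        by (intro continuous_intros contK continuous_on_subset[OF C(6) sub]) (auto simp: K_def)
      show "inj_on \<kappa>' (ball 0 \<rho>)"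
      proof (rule inj_onI)
        fix v w assume vw: "v \<in> ball 0 \<rho>" "w \<in> ball 0 \<rho>" "\<kappa>' v = \<kappa>' w"
        then have "\<kappa> v = \<kappa> w" using \<kappa>'(1) by metis
        then show "v = w" using inj_onD[OF C(7)] vw sub by blast
      qed
      show "\<kappa>' \<in> ball 0 \<rho> \<rightarrow> ?X" using \<kappa>'(2) C(8) sub by (auto simp: Pi_iff subset_iff)
      show "h (\<alpha> z) = \<kappa>' (z ^ deg y)" if "z \<in> ball 0 \<rho>" for z
        using f\<alpha>(1)[OF that] c(2)[OF that] by (simp add: h_def \<kappa>'_def)
    qed (rule C(5))
  qed
  moreover have "h \<in> ?Y \<rightarrow> ?X" using h_norm intoX by (auto simp: Pi_iff)
  moreover have "finite (sphere_power s -` (B \<union> ?N))"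
    using finite_sphere_power_vimage[OF s] finite_exceptional by simp
  ultimately have "ramified_sphere_map h deg (sphere_power s -` (B \<union> ?N))"
    by unfold_locales (use dim_domain dim_target in auto)
  then show ?thesis using that h_pow by metis
qed

section \<open>Moving two points of the sphere to the poles\<close>

text \<open>
  The ray from \<open>c\<close> in direction \<open>u\<close> meets the sphere where a quadratic equation holds for the distance
  \<open>a\<close> from \<open>c\<close>. The product of its two roots is \<open>c \<bullet> c - 1 < 0\<close>, so exactly one root is positive.
\<close>

lemma projection_from_interior_homeomorphism:
  fixes c :: "'a::euclidean_space"
  assumes "norm c < 1"
  shows "\<exists>g. homeomorphism (sphere 0 1) (sphere 0 1) (\<lambda>x. (x - c) /\<^sub>R norm (x - c)) g"
proof (rule homeomorphism_compact)
  let ?\<pi> = "\<lambda>x. (x - c) /\<^sub>R norm (x - c)"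
  have nc: "x - c \<noteq> 0" if "x \<in> sphere 0 1" for x using that assms by auto
  have nn: "c \<bullet> c < 1" using assms by (simp add: norm_lt_square)
  have on_sphere: "(norm (c + a *\<^sub>R u) = 1) \<longleftrightarrow> a * a + 2 * a * (c \<bullet> u) + c \<bullet> c = 1"
    if "norm u = 1" for a u
  proof -
    have "u \<bullet> u = 1" using that by (simp add: norm_eq_1)
    then show ?thesis
      by (simp add: norm_eq_1 inner_add_left inner_add_right inner_commute algebra_simps)
  qed
  show "continuous_on (sphere 0 1) ?\<pi>"
    using nc by (intro continuous_intros) auto
  show "inj_on ?\<pi> (sphere 0 1)"
  proof (rule inj_onI)
    fix x y assume x: "x \<in> sphere 0 1" and y: "y \<in> sphere 0 1" and eq: "?\<pi> x = ?\<pi> y"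
    define u where "u = ?\<pi> x"
    define a where "a = norm (x - c)"
    define b where "b = norm (y - c)"
    have u: "norm u = 1" and ab: "a > 0" "b > 0" using nc[OF x] nc[OF y] by (simp_all add: u_def a_def b_def)
    have xa: "x = c + a *\<^sub>R u" using ab by (simp add: u_def a_def)
    have yb: "y = c + b *\<^sub>R u" using ab unfolding u_def eq by (simp add: b_def)
    have "a * a + 2 * a * (c \<bullet> u) + c \<bullet> c = 1" "b * b + 2 * b * (c \<bullet> u) + c \<bullet> c = 1"
      using x y on_sphere[OF u] unfolding xa yb by auto
    then have "(a - b) * (a * b + (1 - c \<bullet> c)) = 0" by algebra
    moreover have "a * b + (1 - c \<bullet> c) > 0" using ab nn by (simp add: add_pos_pos)
    ultimately show "x = y" using xa yb by simp
  qed
  show "?\<pi> ` sphere 0 1 = sphere 0 1"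
  proof (intro set_eqI iffI)
    fix u assume "u \<in> ?\<pi> ` sphere 0 1"
    then show "u \<in> sphere 0 1" using nc by auto
  next
    fix u :: 'a assume "u \<in> sphere 0 1"
    then have u: "norm u = 1" by simp
    \<comment> \<open>a quarter of the discriminant of the quadratic equation for \<open>a\<close>\<close>
    define D where "D = (c \<bullet> u)\<^sup>2 + (1 - c \<bullet> c)"
    define a where "a = sqrt D - c \<bullet> u"
    have D: "D > (c \<bullet> u)\<^sup>2" using nn by (simp add: D_def)
    then have "sqrt D > \<bar>c \<bullet> u\<bar>" by (metis real_sqrt_abs real_sqrt_less_iff)
    then have a: "a > 0" by (simp add: a_def)
    have "0 \<le> D" using D zero_le_power2[of "c \<bullet> u"] by linarith
    then have "(sqrt D)\<^sup>2 = D" by (rule real_sqrt_pow2)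
    then have "a * a + 2 * a * (c \<bullet> u) + c \<bullet> c = 1"
      by (simp add: a_def D_def power2_eq_square algebra_simps)
    then have "c + a *\<^sub>R u \<in> sphere 0 1" using on_sphere[OF u] by simp
    moreover have "?\<pi> (c + a *\<^sub>R u) = u" using a u by simp
    ultimately show "u \<in> ?\<pi> ` sphere 0 1" by (intro image_eqI[of _ _ "c + a *\<^sub>R u"]) auto
  qed
qed (rule compact_sphere)

text \<open>
  The reflection in the hyperplane orthogonal to \<open>u - n\<close>. If \<open>u = n\<close>, division by zero
  makes the formula the identity.
\<close>

lemma reflection_of_sphere:
  fixes u n :: "'a::euclidean_space"
  assumes "u \<in> sphere 0 1" "n \<in> sphere 0 1"
  obtains \<rho> where "homeomorphism (sphere 0 1) (sphere 0 1) \<rho> \<rho>" "\<rho> u = n" "\<rho> (- u) = - n"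
proof -
  define v where "v = u - n"
  define \<rho> where "\<rho> x = x - (2 * (x \<bullet> v) / (v \<bullet> v)) *\<^sub>R v" for x
  have nm: "norm (\<rho> x) = norm x" for x
  proof (cases "v = 0")
    case False
    then have "v \<bullet> v \<noteq> 0" by simp
    then have "\<rho> x \<bullet> \<rho> x = x \<bullet> x"
      by (simp add: \<rho>_def inner_diff_left inner_diff_right inner_commute field_simps)
    then show ?thesis by (simp add: norm_eq)
  qed (simp add: \<rho>_def)
  have invol: "\<rho> (\<rho> x) = x" for x
  proof (cases "v = 0")
    case False
    then have "v \<bullet> v \<noteq> 0" by simp
    then have "\<rho> x \<bullet> v = - (x \<bullet> v)" by (simp add: \<rho>_def inner_diff_left)
    then show ?thesis by (simp add: \<rho>_def[of "\<rho> x"]) (simp add: \<rho>_def)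
  qed (simp add: \<rho>_def)
  have cont: "continuous_on T \<rho>" for T unfolding \<rho>_def by (cases "v = 0") (auto intro!: continuous_intros)
  have un: "\<rho> u = n"
  proof (cases "v = 0")
    case False
    have "u \<bullet> u = 1" "n \<bullet> n = 1" using assms by (auto simp: norm_eq_1)
    then have "v \<bullet> v = 2 * (u \<bullet> v)" by (simp add: v_def inner_diff_left inner_diff_right inner_commute)
    then have "2 * (u \<bullet> v) / (v \<bullet> v) = 1" using False by (metis divide_self inner_eq_zero_iff)
    then show ?thesis unfolding \<rho>_def by (simp only:) (simp add: v_def)
  qed (simp add: \<rho>_def v_def)
  show ?thesis
  proof (rule that)
    show "homeomorphism (sphere 0 1) (sphere 0 1) \<rho> \<rho>"
      by (rule homeomorphismI) (use nm invol cont in auto)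
    have "\<rho> (- u) = - \<rho> u" by (simp add: \<rho>_def)
    then show "\<rho> (- u) = - n" using un by simp
  qed (rule un)
qed

text \<open>
  Projection from the midpoint of the chord between two points makes them antipodal; a
  reflection then carries them to the poles.
\<close>

lemma sphere_homeomorphism_to_poles:
  fixes x1 x2 :: "'b::euclidean_space"
  assumes dim: "DIM('b) = 3" and x: "x1 \<in> sphere 0 1" "x2 \<in> sphere 0 1" "x1 \<noteq> x2"
  obtains \<tau> \<tau>' where "homeomorphism (sphere 0 1) (sphere (0::complex \<times> real) 1) \<tau> \<tau>'"
    "\<tau> x1 = (0, 1)" "\<tau> x2 = (0, -1)"
proof -
  let ?X = "sphere (0::complex \<times> real) 1"
  have "sphere (0::'b) 1 homeomorphic ?X" by (rule homeomorphic_spheres_gen) (use dim in auto)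
  then obtain \<iota> \<iota>' where \<iota>: "homeomorphism (sphere (0::'b) 1) ?X \<iota> \<iota>'" unfolding homeomorphic_def by blast
  define a where "a = \<iota> x1"
  define b where "b = \<iota> x2"
  have ab: "norm a = 1" "norm b = 1" "a \<noteq> b"
    using homeomorphism_image1[OF \<iota>] homeomorphism_apply1[OF \<iota>] x unfolding a_def b_def
    by (force, force, metis)
  define c where "c = (1/2) *\<^sub>R (a + b)"
  have "norm c < 1"
  proof -
    have "norm (a + b) \<noteq> norm a + norm b"
      unfolding norm_triangle_eq using ab by auto
    then have "norm (a + b) < 2" using norm_triangle_ineq[of a b] ab by simp
    then show ?thesis by (simp add: c_def)
  qed
  then obtain g where g: "homeomorphism ?X ?X (\<lambda>x. (x - c) /\<^sub>R norm (x - c)) g"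
    using projection_from_interior_homeomorphism by blast
  let ?\<pi> = "\<lambda>x. (x - c) /\<^sub>R norm (x - c)"
  have ac: "a - c = (1/2) *\<^sub>R (a - b)" and bc: "b - c = - ((1/2) *\<^sub>R (a - b))"
    by (simp_all add: c_def algebra_simps flip: scaleR_add_left)
  have opp: "?\<pi> b = - ?\<pi> a" unfolding ac bc by simp
  have "?\<pi> a \<in> ?\<pi> ` ?X" using ab by (intro imageI) simp
  then have "?\<pi> a \<in> ?X" unfolding homeomorphism_image1[OF g] .
  moreover have "(0, 1) \<in> ?X" by (simp add: norm_prod_def)
  ultimately obtain \<rho> where \<rho>: "homeomorphism ?X ?X \<rho> \<rho>" "\<rho> (?\<pi> a) = (0, 1)" "\<rho> (- ?\<pi> a) = - (0, 1)"
    by (rule reflection_of_sphere)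
  show ?thesis
  proof (rule that)
    show "homeomorphism (sphere 0 1) ?X (\<rho> \<circ> (?\<pi> \<circ> \<iota>)) ((\<iota>' \<circ> g) \<circ> \<rho>)"
      by (rule homeomorphism_compose[OF homeomorphism_compose[OF \<iota> g] \<rho>(1)])
    show "(\<rho> \<circ> (?\<pi> \<circ> \<iota>)) x1 = (0, 1)" using \<rho>(2) by (simp add: a_def)
    show "(\<rho> \<circ> (?\<pi> \<circ> \<iota>)) x2 = (0, -1)" using \<rho>(3) opp by (simp add: b_def)
  qed
qed

lemma ramified_sphere_map_compose_homeomorphism:
  fixes f :: "'a::euclidean_space \<Rightarrow> 'b::euclidean_space" and \<tau> :: "'b \<Rightarrow> 'c::euclidean_space"
  assumes "ramified_sphere_map f deg B" and \<tau>: "homeomorphism (sphere 0 1) (sphere 0 1) \<tau> \<tau>'"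
    and dim: "DIM('c) = 3"
  shows "ramified_sphere_map (\<tau> \<circ> f) deg (\<tau> ` (B \<inter> sphere 0 1))"
proof -
  interpret ramified_sphere_map f deg B by (rule assms(1))
  note cont\<tau> = homeomorphism_cont1[OF \<tau>]
  have im\<tau>: "\<tau> x \<in> sphere 0 1" if "x \<in> sphere 0 1" for x
    using homeomorphism_image1[OF \<tau>] that by blast
  have inj\<tau>: "inj_on \<tau> (sphere 0 1)" using homeomorphism_apply1[OF \<tau>] by (rule inj_on_inverseI)
  show ?thesis
  proof
    show "continuous_on (sphere 0 1) (\<tau> \<circ> f)"
      using continuous cont\<tau> into by (intro continuous_on_compose) (auto intro: continuous_on_subset)
    show "\<tau> \<circ> f \<in> sphere 0 1 \<rightarrow> sphere 0 1" using into im\<tau> by (auto simp only: Pi_iff o_apply)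
    show "finite (\<tau> ` (B \<inter> sphere 0 1))" using finite_exceptional by simp
    fix y :: 'a assume y: "y \<in> sphere 0 1" "(\<tau> \<circ> f) y \<notin> \<tau> ` (B \<inter> sphere 0 1)"
    then have "f y \<notin> B" using into by (auto simp only: Pi_iff o_apply)
    then obtain \<alpha> \<kappa> where c: "power_chart (sphere 0 1) (sphere 0 1) f y (deg y) \<alpha> \<kappa>"
      using model y(1) unfolding power_model_def by blast
    note C = power_chartD[OF c]
    have im: "\<kappa> ` ball 0 1 \<subseteq> sphere 0 1" using C(8) by blast
    have "power_chart (sphere 0 1) (sphere 0 1) (\<tau> \<circ> f) y (deg y) \<alpha> (\<tau> \<circ> \<kappa>)"
      unfolding power_chart_def
    proof (intro conjI C ballI)
      show "continuous_on (ball 0 1) (\<tau> \<circ> \<kappa>)"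
        using C(6) continuous_on_subset[OF cont\<tau> im] by (rule continuous_on_compose)
      show "inj_on (\<tau> \<circ> \<kappa>) (ball 0 1)"
        using C(7) inj_on_subset[OF inj\<tau> im] by (rule comp_inj_on)
      show "\<tau> \<circ> \<kappa> \<in> ball 0 1 \<rightarrow> sphere 0 1" using im im\<tau> by (auto simp only: Pi_iff o_apply)
      show "(\<tau> \<circ> f) (\<alpha> z) = (\<tau> \<circ> \<kappa>) (z ^ deg y)" if "z \<in> ball 0 1" for z
        using C(9)[OF that] by simp
    qed
    then show "power_model (sphere 0 1) (sphere 0 1) (\<tau> \<circ> f) y (deg y)"
      unfolding power_model_def by blast
  qed (rule dim_domain dim)+
qed

section \<open>Taking roots of branched covers\<close>

text \<open>
  The inductive step of the descent. The points \<open>x1\<close> and \<open>x2\<close> of \<open>Q\<close> are used as branch points of the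
  root \<open>h\<close>, and \<open>Q'\<close> consists of the \<open>s\<close> preimages of each other point of \<open>Q\<close>. The degree of \<open>h\<close> is
  read off at one of these points, since the fibre of \<open>f\<close> there splits into \<open>s\<close> fibres of \<open>h\<close>; for this
  \<open>Q\<close> needs a third point.
\<close>

lemma ramified_sphere_map_root:
  fixes f :: "'a::euclidean_space \<Rightarrow> 'b::euclidean_space"
  assumes ram: "ramified_sphere_map f deg B"
    and degree: "\<And>x. x \<in> sphere 0 1 - B \<Longrightarrow> sum deg (fibre f x) = d" and d: "d > 0"
    and Q: "Q \<subseteq> sphere 0 1 - B" "card Q \<ge> 3" and x: "x1 \<in> Q" "x2 \<in> Q" "x1 \<noteq> x2" and s: "s \<ge> 1"
    and dvd: "\<And>y. y \<in> sphere 0 1 \<Longrightarrow> f y \<in> {x1, x2} \<Longrightarrow> s dvd deg y"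
  obtains h :: "'a \<Rightarrow> complex \<times> real" and B' d' Q'
  where "ramified_sphere_map h deg B'"
    "\<And>x. x \<in> sphere 0 1 - B' \<Longrightarrow> sum deg (fibre h x) = d'" "d = s * d'"
    "Q' \<subseteq> sphere 0 1 - B'" "card Q' = s * (card Q - 2)"
    "\<And>y. y \<in> sphere 0 1 \<Longrightarrow> h y \<in> Q' \<Longrightarrow> f y \<in> Q - {x1, x2}"
proof -
  interpret ramified_sphere_map f deg B by (rule ram)
  let ?Y = "sphere (0::'a) 1" and ?S = "sphere (0::complex \<times> real) 1"
  let ?N = "{(0, 1), (0, -1)} :: (complex \<times> real) set"
  have xS: "x1 \<in> sphere 0 1" "x2 \<in> sphere 0 1" "x1 \<notin> B" "x2 \<notin> B" using Q x by auto
  obtain \<tau> \<tau>' where \<tau>: "homeomorphism (sphere (0::'b) 1) ?S \<tau> \<tau>'"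
    and \<tau>x: "\<tau> x1 = (0, 1)" "\<tau> x2 = (0, -1)"
    using sphere_homeomorphism_to_poles[OF dim_target xS(1,2) x(3)] by blast
  have \<tau>_eq: "\<tau> u = \<tau> v \<longleftrightarrow> u = v" if "u \<in> sphere 0 1" "v \<in> sphere 0 1" for u v
    using homeomorphism_apply1[OF \<tau>] that by metis
  have fS: "f y \<in> sphere 0 1" if "y \<in> ?Y" for y using into that by blast
  have \<tau>S: "\<tau> u \<in> ?S" if "u \<in> sphere 0 1" for u using homeomorphism_image1[OF \<tau>] that by blast
  define B1 where "B1 = \<tau> ` (B \<inter> sphere 0 1)"
  have ram1: "ramified_sphere_map (\<tau> \<circ> f) deg B1"
    unfolding B1_def by (rule ramified_sphere_map_compose_homeomorphism[OF ram \<tau>]) simp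
  have pole_iff: "fst (\<tau> u) = 0 \<longleftrightarrow> u \<in> {x1, x2}" if u: "u \<in> sphere 0 1" for u
    using sphere_pole_iff[OF \<tau>S[OF u]] \<tau>_eq[OF u xS(1)] \<tau>_eq[OF u xS(2)] \<tau>x by auto
  have notB1: "\<tau> u \<notin> B1" if u: "u \<in> sphere 0 1" "u \<notin> B" for u
  proof
    assume "\<tau> u \<in> B1"
    then obtain v where "v \<in> B" "v \<in> sphere 0 1" "\<tau> u = \<tau> v" by (auto simp: B1_def)
    then show False using \<tau>_eq[OF u(1)] u(2) by blast
  qed
  obtain h where ramh: "ramified_sphere_map h deg (sphere_power s -` (B1 \<union> ?N))"
    and h: "\<And>y. y \<in> ?Y \<Longrightarrow> \<tau> (f y) = sphere_power s (h y)"
  proof (rule lift_through_sphere_power[OF ram1 s])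
    show "?N \<inter> B1 = {}" using notB1[OF xS(1,3)] notB1[OF xS(2,4)] \<tau>x by simp
    show "s dvd deg y" if "y \<in> ?Y" "fst ((\<tau> \<circ> f) y) = 0" for y
      using dvd[OF that(1)] pole_iff[OF fS[OF that(1)]] that(2) by simp
    have "sum deg (fibre f x1) \<noteq> 0" using degree[of x1] d xS by simp
    then have "fibre f x1 \<noteq> {}" by auto
    then obtain y where "y \<in> ?Y" "f y = x1" by (auto simp: fibre_def)
    then show "\<exists>y\<in>?Y. fst ((\<tau> \<circ> f) y) = 0" using \<tau>x(1) by (intro bexI[of _ y]) auto
  qed auto
  define B' where "B' = sphere_power s -` (B1 \<union> ?N)"
  define Q0 where "Q0 = Q - {x1, x2}"
  have "finite Q" using Q(2) by (intro card_ge_0_finite) auto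
  then have finQ0: "finite Q0" by (simp add: Q0_def)
  have cardQ0: "card Q0 = card Q - 2"
    using x \<open>finite Q\<close> unfolding Q0_def by (subst card_Diff_subset) auto
  have Q0: "u \<in> sphere 0 1" "u \<notin> B" "fst (\<tau> u) \<noteq> 0" if "u \<in> Q0" for u
    using that Q(1) pole_iff[of u] unfolding Q0_def by auto
  define Fib where "Fib u = sphere_power s -` {\<tau> u}" for u
  have cardFib: "card (Fib u) = s" if "u \<in> Q0" for u
    unfolding Fib_def by (rule sphere_power_fibre[OF s Q0(3)[OF that]])
  have FibS: "Fib u \<subseteq> ?S - B'" if u: "u \<in> Q0" for u
  proof
    fix p assume "p \<in> Fib u"
    then have p: "sphere_power s p = \<tau> u" by (simp add: Fib_def)
    have "\<tau> u \<notin> B1 \<union> ?N" using notB1[OF Q0(1,2)[OF u]] Q0(3)[OF u] by auto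
    moreover have "norm p = 1" using norm_sphere_power[of s p] p \<tau>S[OF Q0(1)[OF u]] by simp
    ultimately show "p \<in> ?S - B'" using p by (simp add: B'_def)
  qed
  define Q' where "Q' = (\<Union>u\<in>Q0. Fib u)"
  have Q'S: "Q' \<subseteq> ?S - B'" using FibS unfolding Q'_def by blast
  have finFib: "finite (Fib u)" if "u \<in> Q0" for u
    using cardFib[OF that] s by (intro card_ge_0_finite) simp
  have cardQ': "card Q' = s * (card Q - 2)"
  proof -
    have "card Q' = (\<Sum>u\<in>Q0. card (Fib u))"
      unfolding Q'_def
    proof (rule card_UN_disjoint[OF finQ0])
      show "\<forall>u\<in>Q0. finite (Fib u)" using finFib by blast
      show "\<forall>u\<in>Q0. \<forall>v\<in>Q0. u \<noteq> v \<longrightarrow> Fib u \<inter> Fib v = {}"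
        using \<tau>_eq Q0(1) unfolding Fib_def by auto
    qed
    then show ?thesis using cardFib cardQ0 by simp
  qed
  have "card Q0 > 0" using cardQ0 Q(2) by simp
  then obtain u0 where u0: "u0 \<in> Q0" by (metis card_gt_0_iff ex_in_conv)
  then have "Fib u0 \<noteq> {}" using cardFib s by fastforce
  then obtain p0 where p0: "p0 \<in> Fib u0" by blast
  define d' where "d' = sum deg (fibre h p0)"
  interpret H: ramified_sphere_map h deg B' unfolding B'_def by (rule ramh)
  have degh: "sum deg (fibre h p) = d'" if "p \<in> ?S - B'" for p
    unfolding d'_def using that FibS[OF u0] p0 by (intro H.fibre_sum_constant) auto
  have "d = s * d'"
  proof -
    have "fibre f u0 = (\<Union>p\<in>Fib u0. fibre h p)"
    proof (intro set_eqI iffI)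
      fix y assume "y \<in> fibre f u0"
      then show "y \<in> (\<Union>p\<in>Fib u0. fibre h p)" using h[of y] by (auto simp: fibre_def Fib_def)
    next
      fix y assume "y \<in> (\<Union>p\<in>Fib u0. fibre h p)"
      then have y: "y \<in> ?Y" "sphere_power s (h y) = \<tau> u0" by (auto simp: fibre_def Fib_def)
      then have "\<tau> (f y) = \<tau> u0" using h by simp
      then show "y \<in> fibre f u0" using \<tau>_eq[OF fS[OF y(1)] Q0(1)[OF u0]] y(1) by (simp add: fibre_def)
    qed
    moreover have "sum deg (\<Union>p\<in>Fib u0. fibre h p) = (\<Sum>p\<in>Fib u0. sum deg (fibre h p))"
    proof (rule sum.UNION_disjoint[OF finFib[OF u0]])
      show "\<forall>p\<in>Fib u0. finite (fibre h p)" using H.finite_fibre FibS[OF u0] by blast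
      show "\<forall>p\<in>Fib u0. \<forall>q\<in>Fib u0. p \<noteq> q \<longrightarrow> fibre h p \<inter> fibre h q = {}"
        by (auto simp: fibre_def)
    qed
    moreover have "\<dots> = (\<Sum>p\<in>Fib u0. d')"
      using degh FibS[OF u0] by (intro sum.cong) auto
    ultimately show ?thesis using degree[of u0] Q0[OF u0] cardFib[OF u0] by simp
  qed
  moreover have "f y \<in> Q - {x1, x2}" if y: "y \<in> ?Y" "h y \<in> Q'" for y
  proof -
    obtain u where u: "u \<in> Q0" "sphere_power s (h y) = \<tau> u" using y(2) by (auto simp: Q'_def Fib_def)
    then have "f y = u" using h[OF y(1)] \<tau>_eq[OF fS[OF y(1)] Q0(1)[OF u(1)]] by simp
    then show ?thesis using u(1) by (simp add: Q0_def)
  qed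
  ultimately show ?thesis
    using that[OF H.ramified_sphere_map_axioms degh _ Q'S cardQ'] by blast
qed

lemma degree_dvd_if_fibre_divisible:
  assumes "\<And>x. x \<in> sphere 0 1 - B \<Longrightarrow> sum deg (fibre f x) = d" "x \<in> sphere 0 1 - B"
    and "\<And>y. y \<in> sphere 0 1 \<Longrightarrow> f y = x \<Longrightarrow> t dvd deg y"
  shows "t dvd (d::nat)"
proof -
  have "t dvd sum deg (fibre f x)" by (rule dvd_sum) (use assms(3) in \<open>auto simp: fibre_def\<close>)
  then show ?thesis using assms(1,2) by simp
qed

lemma two_elements:
  assumes "card Q \<ge> 2"
  obtains x y where "x \<in> Q" "y \<in> Q" "x \<noteq> y"
proof -
  obtain T where "T \<subseteq> Q" "card T = 2" using obtain_subset_with_card_n[OF assms] by blast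
  then show ?thesis using that unfolding card_2_iff by blast
qed

text \<open>
  Taking a root of order \<open>t\<close> at two points of \<open>Q\<close> preserves all hypotheses, because \<open>Q\<close> does not shrink,
  and divides the degree by \<open>t\<close>. A positive degree cannot decrease for ever.
\<close>

lemma no_cover_with_many_divisible_fibres:
  fixes f :: "'a::euclidean_space \<Rightarrow> complex \<times> real"
  assumes "ramified_sphere_map f deg B"
    and "\<And>x. x \<in> sphere 0 1 - B \<Longrightarrow> sum deg (fibre f x) = d" "d > 0"
    and "Q \<subseteq> sphere 0 1 - B" "card Q \<ge> 3"
    and t: "t \<ge> 2" and many: "t * (card Q - 2) \<ge> card Q"
    and "\<And>y. y \<in> sphere 0 1 \<Longrightarrow> f y \<in> Q \<Longrightarrow> t dvd deg y"
  shows False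
  using assms(1-5,7,8)
proof (induction d arbitrary: f B Q rule: less_induct)
  case (less d)
  obtain x1 x2 where x: "x1 \<in> Q" "x2 \<in> Q" "x1 \<noteq> x2"
    by (rule two_elements[of Q]) (use less.prems(5) in simp)
  obtain h :: "'a \<Rightarrow> complex \<times> real" and B' d' Q' where h: "ramified_sphere_map h deg B'"
    "\<And>x. x \<in> sphere 0 1 - B' \<Longrightarrow> sum deg (fibre h x) = d'" "d = t * d'"
    "Q' \<subseteq> sphere 0 1 - B'" "card Q' = t * (card Q - 2)"
    "\<And>y. y \<in> sphere 0 1 \<Longrightarrow> h y \<in> Q' \<Longrightarrow> f y \<in> Q - {x1, x2}"
    by (rule ramified_sphere_map_root[OF less.prems(1-5) x, of t]) (use t less.prems(7) x in auto)
  show False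
  proof (rule less.IH[of d' h B' Q'])
    show "d' < d" "d' > 0" using h(3) t less.prems(3) by auto
    have "card Q' \<ge> card Q" using h(5) less.prems(6) by simp
    then show "card Q' \<ge> 3" using less.prems(5) by simp
    have "t * (card Q - 2) \<le> t * (card Q' - 2)" using \<open>card Q' \<ge> card Q\<close>
      by (intro mult_left_mono diff_le_mono) auto
    then show "t * (card Q' - 2) \<ge> card Q'" using h(5) by simp
    show "t dvd deg y" if "y \<in> sphere 0 1" "h y \<in> Q'" for y
      using less.prems(7)[OF that(1)] h(6)[OF that] by blast
  qed (fact h)+
qed

section \<open>Branching data\<close>

lemma branched_cover_ramified_sphere_map:
  fixes f :: "'a::euclidean_space \<Rightarrow> 'b::euclidean_space"
  assumes "DIM('a) = 3" "DIM('b) = 3" and f: "branched_cover (sphere 0 1) (sphere 0 1) f"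
  shows "ramified_sphere_map f (local_degree (sphere 0 1) (sphere 0 1) f) {}"
proof
  show "f \<in> sphere 0 1 \<rightarrow> sphere 0 1" using f unfolding branched_cover_def by blast
  fix y :: 'a assume "y \<in> sphere 0 1"
  then obtain m where "locally_power_map (sphere 0 1) (sphere 0 1) f y m"
    using f unfolding branched_cover_def by blast
  then show "power_model (sphere 0 1) (sphere 0 1) f y (local_degree (sphere 0 1) (sphere 0 1) f y)"
    using locally_power_map_imp_power_model local_degree_eqI by metis
qed (use assms branched_cover_continuous_on in auto)

text \<open>
  Entries of the branching data may coincide as partitions but come from different branch points.
\<close>

lemma image_mset_mset_set_three:
  assumes "image_mset g (mset_set S) = add_mset a (add_mset b (add_mset c R))"
  obtains x y z where "{x, y, z} \<subseteq> S" "x \<noteq> y" "x \<noteq> z" "y \<noteq> z" "g x = a" "g y = b" "g z = c"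
proof -
  obtain M x where x: "mset_set S = add_mset x M" "g x = a" "image_mset g M = add_mset b (add_mset c R)"
    using msed_map_invR[OF assms] by blast
  obtain M' y where y: "M = add_mset y M'" "g y = b" "image_mset g M' = add_mset c R"
    using msed_map_invR[OF x(3)] by blast
  obtain M'' z where z: "M' = add_mset z M''" "g z = c"
    using msed_map_invR[OF y(3)] by blast
  have eq: "mset_set S = {#x, y, z#} + M''" using x(1) y(1) z(1) by simp
  have "finite S" using x(1) by (metis add_mset_not_empty mset_set.infinite)
  then have "{x, y, z} \<subseteq> S"
    using eq by (metis finite_set_mset_mset_set set_mset_add_mset_insert set_mset_empty set_mset_union sup_ge1)
  have le: "count ({#x, y, z#} + M'') w \<le> 1" for w
    unfolding eq[symmetric] by (cases "w \<in> S") (auto simp: count_mset_set')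
  have "x \<noteq> y" "x \<noteq> z" "y \<noteq> z" using le[of x] le[of y] le[of z] by (auto split: if_splits)
  with \<open>{x, y, z} \<subseteq> S\<close> show ?thesis using that x(2) y(2) z(2) by blast
qed

theorem proposition1p1:
  fixes s t d' n :: nat
    and A :: "nat \<Rightarrow> nat multiset"
    and a :: "nat \<Rightarrow> nat \<Rightarrow> nat"
    and r :: "nat \<Rightarrow> nat"
  assumes "s \<ge> 2" "t \<ge> 1" "d' \<ge> 1" "n \<ge> 3"
    and "\<And>k. k \<in> {1..n} \<Longrightarrow> nontrivial_partition (s * d') (A k)"
    and "\<And>k l. k \<in> {1..n} \<Longrightarrow> l \<in> {1..r k} \<Longrightarrow> a k l \<ge> 1"
    and "A 1 = {# s * a 1 l. l \<in># mset_set {1..r 1} #}"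
    and "A 2 = {# s * a 2 l. l \<in># mset_set {1..r 2} #}"
    and "A 3 = {# t * a 3 l. l \<in># mset_set {1..r 3} #}"
    and "\<And>k. k \<in> {4..n} \<Longrightarrow> A k = {# a k l. l \<in># mset_set {1..r k} #}"
    and "\<exists>f. branched_cover (sphere (0::real^3) 1) (sphere (0::real^3) 1) f \<and>
             branching_data (sphere (0::real^3) 1) (sphere (0::real^3) 1) f =
               {# A k. k \<in># mset_set {1..n} #}"
  shows "(s \<ge> 4 \<longrightarrow> t = 1) \<and>
         (s = 3 \<longrightarrow> t \<in> {1, 2} \<and> (t = 2 \<longrightarrow> 4 dvd d')) \<and>
         (s = 2 \<longrightarrow> t \<ge> 1 \<and> (t \<ge> 2 \<longrightarrow> t dvd d'))"
proof -
  let ?S = "sphere (0::real^3) 1"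
  obtain f where f: "branched_cover ?S ?S f"
    and data: "branching_data ?S ?S f = {# A k. k \<in># mset_set {1..n} #}"
    using assms(11) by blast
  define deg where "deg = local_degree ?S ?S f"
  interpret ramified_sphere_map f deg "{}"
    unfolding deg_def by (rule branched_cover_ramified_sphere_map[OF _ _ f]) auto
  have "{1..n} = insert 1 (insert 2 (insert 3 {4..n}))" using assms(4) by auto
  then have "image_mset (fibre_partition ?S ?S f) (mset_set (branch_points ?S ?S f)) =
      add_mset (A 1) (add_mset (A 2) (add_mset (A 3) {# A k. k \<in># mset_set {4..n} #}))"
    using data unfolding branching_data_def by simp
  then obtain x1 x2 x3 where x: "{x1, x2, x3} \<subseteq> branch_points ?S ?S f"
      "x1 \<noteq> x2" "x1 \<noteq> x3" "x2 \<noteq> x3"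
    and parts: "fibre_partition ?S ?S f x1 = A 1" "fibre_partition ?S ?S f x2 = A 2"
      "fibre_partition ?S ?S f x3 = A 3"
    by (rule image_mset_mset_set_three)
  define Q where "Q = {x1, x2, x3}"
  have xS: "Q \<subseteq> ?S - {}" using x(1) by (auto simp: Q_def branch_points_def)
  have cardQ: "card Q = 3" using x by (simp add: Q_def)
  have partition: "fibre_partition ?S ?S f x = image_mset deg (mset_set (fibre f x))" for x
    by (simp add: fibre_partition_def deg_def fibre_def)
  have deg_in: "deg y \<in># fibre_partition ?S ?S f (f y)" if "y \<in> ?S" for y
    using finite_fibre[of "f y"] that unfolding partition by (auto simp: fibre_def)
  have "sum deg (fibre f x1) = s * d'"
    using assms(5)[of 1] assms(4) parts(1) unfolding nontrivial_partition_def partition_of_def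
    by (simp add: partition sum_unfold_sum_mset)
  then have degree: "sum deg (fibre f x) = s * d'" if "x \<in> ?S - {}" for x
    using fibre_sum_constant[OF that, of x1] xS by (auto simp: Q_def)
  have dvd_s: "s dvd deg y" if y: "y \<in> ?S" "f y \<in> {x1, x2}" for y
    using deg_in[OF y(1)] y(2) parts(1,2) assms(7,8) by auto
  have dvd_t: "t dvd deg y" if y: "y \<in> ?S" "f y = x3" for y
    using deg_in[OF y(1)] y(2) parts(3) assms(9) by auto
  have pos: "s * d' > 0" using assms by simp
  \<comment> \<open>the root of order \<open>s\<close> branched at the first two branch points\<close>
  obtain h :: "real^3 \<Rightarrow> complex \<times> real" and B' e Q' where h: "ramified_sphere_map h deg B'"
    "\<And>x. x \<in> sphere 0 1 - B' \<Longrightarrow> sum deg (fibre h x) = e" "s * d' = s * e"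
    "Q' \<subseteq> sphere 0 1 - B'" "card Q' = s * (card Q - 2)"
    "\<And>y. y \<in> ?S \<Longrightarrow> h y \<in> Q' \<Longrightarrow> f y \<in> Q - {x1, x2}"
    by (rule ramified_sphere_map_root[OF ramified_sphere_map_axioms degree pos xS, of x1 x2 s])
      (use cardQ x assms(1) dvd_s in \<open>auto simp: Q_def\<close>)
  have e: "e = d'" using h(3) assms(1) by simp
  have cardQ': "card Q' = s" using h(5) cardQ by simp
  have dvd_t': "t dvd deg y" if "y \<in> ?S" "h y \<in> Q'" for y
    using h(6)[OF that] dvd_t[OF that(1)] by (auto simp: Q_def)
  have contra: False if "t \<ge> 2" "s \<ge> 3" "s \<le> t * (s - 2)"
    by (rule no_cover_with_many_divisible_fibres[OF h(1,2) _ h(4) _ that(1)])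
      (use e assms(3) cardQ' that dvd_t' in auto)
  have "t dvd d'"
  proof -
    have "Q' \<noteq> {}" using cardQ' assms(1) by auto
    then obtain q where "q \<in> Q'" by blast
    then show ?thesis
      using degree_dvd_if_fibre_divisible[of B' deg h e q t] h(2,4) dvd_t' e by blast
  qed
  moreover have "t = 1" if "s \<ge> 4"
  proof (rule ccontr)
    assume "t \<noteq> 1"
    then have "t \<ge> 2" using assms(2) by simp
    moreover have "2 * (s - 2) \<le> t * (s - 2)" using \<open>t \<ge> 2\<close> by (rule mult_right_mono) simp
    ultimately show False using that contra by linarith
  qed
  moreover have "t \<in> {1, 2} \<and> (t = 2 \<longrightarrow> 4 dvd d')" if s3: "s = 3"
  proof (intro conjI impI)
    show "t \<in> {1, 2}"
    proof (rule ccontr)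
      assume "t \<notin> {1, 2}"
      then have "t \<ge> 3" using assms(2) by auto
      then show False using contra s3 by simp
    qed
  next
    assume t2: "t = 2"
    \<comment> \<open>a square root branched at two of the three points of \<open>Q'\<close>\<close>
    have "card Q' \<ge> 3" using cardQ' s3 by simp
    obtain q1 q2 where q: "q1 \<in> Q'" "q2 \<in> Q'" "q1 \<noteq> q2"
      by (rule two_elements[of Q']) (use \<open>card Q' \<ge> 3\<close> in simp)
    have "e > 0" using e assms(3) by simp
    obtain k :: "real^3 \<Rightarrow> complex \<times> real" and B'' d'' Q'' where k: "ramified_sphere_map k deg B''"
      "\<And>x. x \<in> sphere 0 1 - B'' \<Longrightarrow> sum deg (fibre k x) = d''" "e = 2 * d''"
      "Q'' \<subseteq> sphere 0 1 - B''" "card Q'' = 2 * (card Q' - 2)"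
      "\<And>y. y \<in> ?S \<Longrightarrow> k y \<in> Q'' \<Longrightarrow> h y \<in> Q' - {q1, q2}"
      by (rule ramified_sphere_map_root[OF h(1,2) \<open>e > 0\<close> h(4) \<open>card Q' \<ge> 3\<close> q, of 2])
        (use dvd_t' t2 q in auto)
    have "Q'' \<noteq> {}" using k(5) cardQ' s3 by auto
    then obtain q where "q \<in> Q''" by blast
    then have "2 dvd d''"
      using degree_dvd_if_fibre_divisible[of B'' deg k d'' q 2] k(2,4,6) dvd_t' t2 by blast
    then show "4 dvd d'" using k(3) e by auto
  qed
  ultimately show ?thesis using assms(2) by blast
qed

end
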